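(* Let $K=\mathfrak{b}(p,q)$ be the two-bridge knot of fraction $p/q$, so that $p=\det K$. Then every irreducible traceless $\mathrm{SU}(2)$ representation of $\pi_1(S^3\setminus K)$ is binary-dihedral. Up to conjugacy there are exactly $(p-1)/2$ irreducible traceless $\mathrm{SU}(2)$ representations: writing $\omega$ for the meridian-pair angle, they occur at $\cos\omega=\cos(2\pi k/p)$ for $k=1,\dots,(p-1)/2$ (one for each $k$), independently of $q$. Equivalently, the traceless Riley polynomial in the variable $u=2\cos\omega-2$ is $$\phi_p(u)=\prod_{k=1}^{(p-1)/2}\Bigl(u+4\sin^2\tfrac{\pi k}{p}\Bigr),$$ which is monic of degree $(p-1)/2$, has integer coefficients, satisfies $\phi_p(0)=p=\det K$, and has sum of roots equal to $-p$.
   Context: Two-bridge knots: $p\ge 3$ is odd and $\gcd(p,q)=1$; the knot $\mathfrak{b}(p,q)$ depends only on $q$ modulo $p$, so one may take $q$ odd with $-p<q<p$. The double branched cover of $\mathfrak b(p,q)$ is the lens space $L(p,q)$. The knot group has the standard presentation $\pi_1(S^3\setminus K)=\langle a,b\mid wa=bw\rangle$ with $a,b$ (conjugate) meridians, $w=a^{\epsilon_1}b^{\epsilon_2}\cdots a^{\epsilon_{p-2}}b^{\epsilon_{p-1}}$ and $\epsilon_i=(-1)^{\lfloor iq/p\rfloor}$ ($q$ odd). Traceless: identify $\mathrm{SU}(2)$ with the unit quaternions. A representation $\rho:\pi_1(S^3\setminus K)\to\mathrm{SU}(2)$ is traceless if every meridian is sent to a trace-zero element, i.e. to a purely imaginary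 unit quaternion, a point of the unit sphere $S\subset\operatorname{Im}\mathbb{H}\cong\mathbb{R}^3$. Representations are counted up to conjugation in $\mathrm{SU}(2)$ (characters). Meridian-pair angle: for a traceless $\rho$, $\omega$ is the angle between the vectors $\rho(a),\rho(b)\in S$, i.e. $\cos\omega=\langle\rho(a),\rho(b)\rangle$, for the two generating meridians $a,b$ above. Binary-dihedral: a representation is binary-dihedral if, after conjugation, its image lies in $\mathrm{Pin}(2)=S^1\cup jS^1$, where $S^1=\{e^{i\phi}\}$ in the unit quaternions. Traceless Riley polynomial: Riley's parametrization of nonabelian $\mathrm{SL}_2(\mathbb{C})$ representations with meridian eigenvalue $s$ is $$\rho(a)=\begin{pmatrix}s&1\\0&s^{-1}\end{pmatrix},\qquad \rho(b)=\begin{pmatrix}s&0\\-u&s^{-1}\end{pmatrix},$$ and this defines a representation exactly when Riley's polynomial $\Phi_{p,q}(s,u)=W_{11}+(s^{-1}-s)W_{12}$ vanishes, where $W=\rho(w)$; $\Phi_{p,q}$ has degree $(p-1)/2$ in $u$. The traceless locus is $s=i$, where $u=2\cos\omega-2$. The traceless Riley polynomial $\phi_p$ is the monic normalization (in $u$) of $\Phi_{p,q}(i,u)$; its independence of $q$ is part of the assertion. *)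

theory Defs
  imports
    "HOL-Analysis.Analysis"
    "HOL-Algebra.Group"
    "HOL-Computational_Algebra.Computational_Algebra"
begin

section \<open>Groups given by generators and relators\<close>

text \<open>A letter \<open>(g, True)\<close> stands for the generator \<open>g\<close>, and \<open>(g, False)\<close> for its inverse.\<close>

type_synonym 'g word = "('g \<times> bool) list"

definition word_inv :: "'g word \<Rightarrow> 'g word" where
  "word_inv w = rev (map (\<lambda>(g, e). (g, \<not> e)) w)"

inductive pres_eq :: "'g word set \<Rightarrow> 'g word \<Rightarrow> 'g word \<Rightarrow> bool" for R where
  refl: "pres_eq R w w"
| sym: "pres_eq R v w \<Longrightarrow> pres_eq R w v"
| trans: "pres_eq R u v \<Longrightarrow> pres_eq R v w \<Longrightarrow> pres_eq R u w"
| cancel: "pres_eq R (u @ [(g, e), (g, \<not> e)] @ v) (u @ v)"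
| relator: "r \<in> R \<Longrightarrow> pres_eq R (u @ r @ v) (u @ v)"

definition pres_class :: "'g word set \<Rightarrow> 'g word \<Rightarrow> 'g word set" where
  "pres_class R w = {v. pres_eq R w v}"

definition presented_group :: "'g word set \<Rightarrow> 'g word set monoid" where
  "presented_group R =
     \<lparr>carrier = range (pres_class R),
      mult = (\<lambda>X Y. \<Union>x\<in>X. \<Union>y\<in>Y. pres_class R (x @ y)),
      one = pres_class R []\<rparr>"

lemma pres_class_eq_iff: "pres_class R v = pres_class R w \<longleftrightarrow> pres_eq R v w"
  unfolding pres_class_def
  by (auto intro: pres_eq.refl pres_eq.sym pres_eq.trans)

lemma pres_eq_append_left: "pres_eq R v w \<Longrightarrow> pres_eq R (x @ v) (x @ w)"
proof (induction rule: pres_eq.induct)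
  case (cancel u g e v)
  show ?case using pres_eq.cancel[of R "x @ u" g e v] by simp
next
  case (relator r u v)
  then show ?case using pres_eq.relator[of r R "x @ u" v] by simp
qed (blast intro: pres_eq.intros)+

lemma pres_eq_append_right: "pres_eq R v w \<Longrightarrow> pres_eq R (v @ x) (w @ x)"
proof (induction rule: pres_eq.induct)
  case (cancel u g e v)
  show ?case using pres_eq.cancel[of R u g e "v @ x"] by simp
next
  case (relator r u v)
  then show ?case using pres_eq.relator[of r R u "v @ x"] by simp
qed (blast intro: pres_eq.intros)+

lemma pres_eq_append:
  "pres_eq R v w \<Longrightarrow> pres_eq R v' w' \<Longrightarrow> pres_eq R (v @ v') (w @ w')"
  by (meson pres_eq_append_left pres_eq_append_right pres_eq.trans)

lemma pres_class_mult:
  "pres_class R v \<otimes>\<^bsub>presented_group R\<^esub> pres_class R w = pres_class R (v @ w)"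
  by (auto simp: presented_group_def pres_class_def
      intro: pres_eq.refl pres_eq.trans pres_eq_append)

lemma pres_eq_word_inv: "pres_eq R (word_inv w @ w) []"
proof (induction w)
  case Nil
  show ?case by (simp add: word_inv_def pres_eq.refl)
next
  case (Cons l w)
  obtain g e where l: "l = (g, e)" by (cases l)
  have "pres_eq R (word_inv w @ [(g, \<not> e), (g, \<not> \<not> e)] @ w) (word_inv w @ w)"
    by (rule pres_eq.cancel)
  then have "pres_eq R (word_inv (l # w) @ (l # w)) (word_inv w @ w)"
    by (simp add: word_inv_def l)
  then show ?case using Cons by (rule pres_eq.trans)
qed

lemma group_presented_group: "group (presented_group R)"
proof (rule groupI)
  fix X assume "X \<in> carrier (presented_group R)"
  then obtain w where w: "X = pres_class R w"
    by (auto simp: presented_group_def)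
  have one: "\<one>\<^bsub>presented_group R\<^esub> = pres_class R []"
    by (simp add: presented_group_def)
  show "\<one>\<^bsub>presented_group R\<^esub> \<otimes>\<^bsub>presented_group R\<^esub> X = X"
    by (simp add: one w pres_class_mult)
  have "pres_class R (word_inv w) \<otimes>\<^bsub>presented_group R\<^esub> X = \<one>\<^bsub>presented_group R\<^esub>"
    by (simp add: one w pres_class_mult pres_class_eq_iff pres_eq_word_inv)
  then show "\<exists>Y\<in>carrier (presented_group R). Y \<otimes>\<^bsub>presented_group R\<^esub> X = \<one>\<^bsub>presented_group R\<^esub>"
    by (auto simp: presented_group_def)
next
  fix X Y assume "X \<in> carrier (presented_group R)" "Y \<in> carrier (presented_group R)"
  then obtain v w where "X = pres_class R v" "Y = pres_class R w"
    by (auto simp: presented_group_def)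
  then have "X \<otimes>\<^bsub>presented_group R\<^esub> Y = pres_class R (v @ w)"
    by (simp add: pres_class_mult)
  then show "X \<otimes>\<^bsub>presented_group R\<^esub> Y \<in> carrier (presented_group R)"
    by (simp add: presented_group_def)
next
  fix X Y Z
  assume "X \<in> carrier (presented_group R)" "Y \<in> carrier (presented_group R)"
    "Z \<in> carrier (presented_group R)"
  then obtain u v w where "X = pres_class R u" "Y = pres_class R v" "Z = pres_class R w"
    by (auto simp: presented_group_def)
  then show "X \<otimes>\<^bsub>presented_group R\<^esub> Y \<otimes>\<^bsub>presented_group R\<^esub> Z =
      X \<otimes>\<^bsub>presented_group R\<^esub> (Y \<otimes>\<^bsub>presented_group R\<^esub> Z)"
    by (simp add: pres_class_mult)
qed (auto simp: presented_group_def)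

section \<open>The group of a two-bridge knot\<close>

datatype generator = GenA | GenB

text \<open>
  The knot \<open>b(p,q)\<close> depends only on \<open>q\<close> modulo the odd number \<open>p\<close>; the presentation below
  requires the representative that is odd and lies strictly between \<open>-p\<close> and \<open>p\<close>.
\<close>

definition odd_rep :: "nat \<Rightarrow> int \<Rightarrow> int" where
  "odd_rep p q = (if odd (q mod int p) then q mod int p else q mod int p - int p)"

text \<open>The exponent \<open>(-1) ^ \<lfloor>i q / p\<rfloor>\<close> is encoded by its positivity.\<close>

definition two_bridge_word :: "nat \<Rightarrow> int \<Rightarrow> generator word" where
  "two_bridge_word p q =
     map (\<lambda>i. (if odd i then GenA else GenB,
               even \<lfloor>real i * real_of_int (odd_rep p q) / real p\<rfloor>)) [1..<p]"

definition two_bridge_relator :: "nat \<Rightarrow> int \<Rightarrow> generator word" where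
  "two_bridge_relator p q =
     (two_bridge_word p q @ [(GenA, True)]) @ word_inv ([(GenB, True)] @ two_bridge_word p q)"

definition knot_group :: "nat \<Rightarrow> int \<Rightarrow> generator word set monoid" where
  "knot_group p q = presented_group {two_bridge_relator p q}"

definition gen_class :: "nat \<Rightarrow> int \<Rightarrow> generator \<Rightarrow> generator word set" where
  "gen_class p q g = pres_class {two_bridge_relator p q} [(g, True)]"

text \<open>
  A meridian is determined up to conjugation and orientation. The second generator is covered,
  being conjugate to the first by the defining relation.
\<close>

definition meridians :: "nat \<Rightarrow> int \<Rightarrow> generator word set set" where
  "meridians p q = (let G = knot_group p q; a = gen_class p q GenA in
     (\<Union>g\<in>carrier G. {g \<otimes>\<^bsub>G\<^esub> a \<otimes>\<^bsub>G\<^esub> inv\<^bsub>G\<^esub> g, g \<otimes>\<^bsub>G\<^esub> inv\<^bsub>G\<^esub> a \<otimes>\<^bsub>G\<^esub> inv\<^bsub>G\<^esub> g}))"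

text \<open>
  \<open>fox g t w\<close> is the Fox derivative of \<open>w\<close> with respect to \<open>g\<close>, with every generator evaluated
  at \<open>t\<close>. Every meridian abelianizes to the same generator of the first homology, so the
  derivative of the single relator with respect to \<open>a\<close> is the Alexander polynomial of the knot,
  up to a unit \<open>\<plusminus> t ^ n\<close>; its absolute value at \<open>t = -1\<close> is the determinant of the knot.
\<close>

fun fox :: "'g \<Rightarrow> 'k::field \<Rightarrow> 'g word \<Rightarrow> 'k" where
  "fox g t [] = 0"
| "fox g t ((h, e) # w) =
     (if h = g then (if e then 1 else - inverse t) else 0) + (if e then t else inverse t) * fox g t w"

definition alexander :: "nat \<Rightarrow> int \<Rightarrow> real \<Rightarrow> real" where
  "alexander p q t = fox GenA t (two_bridge_relator p q)"

definition knot_det :: "nat \<Rightarrow> int \<Rightarrow> real" where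
  "knot_det p q = \<bar>alexander p q (-1)\<bar>"

section \<open>Traceless representations in SU(2)\<close>

definition adjoint_mat :: "complex^'n^'m \<Rightarrow> complex^'m^'n" where
  "adjoint_mat M = (\<chi> i j. cnj (M $ j $ i))"

definition SU2 :: "(complex^2^2) monoid" where
  "SU2 = \<lparr>carrier = {M. M ** adjoint_mat M = mat 1 \<and> det M = 1}, mult = (**), one = mat 1\<rparr>"

definition quat :: "real \<Rightarrow> real \<Rightarrow> real \<Rightarrow> real \<Rightarrow> complex^2^2" where
  "quat x0 x1 x2 x3 = vector [vector [Complex x0 x1, Complex x2 x3],
                              vector [Complex (- x2) x3, Complex x0 (- x1)]]"

text \<open>
  Identification of the quaternion \<open>x0 + x1 i + x2 j + x3 k\<close> with the matrix
  \<open>quat x0 x1 x2 x3\<close>; the unit quaternions become the special unitary matrices.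
\<close>

lemma quat_relations:
  "quat 0 1 0 0 ** quat 0 1 0 0 = - mat 1"
  "quat 0 0 1 0 ** quat 0 0 1 0 = - mat 1"
  "quat 0 1 0 0 ** quat 0 0 1 0 = quat 0 0 0 1"
  "quat 0 0 1 0 ** quat 0 1 0 0 = - quat 0 0 0 1"
  by (simp_all add: quat_def vec_eq_iff forall_2 matrix_matrix_mult_def sum_2 mat_def
      complex_eq_iff)

lemma carrier_SU2:
  "carrier SU2 = {quat x0 x1 x2 x3 | x0 x1 x2 x3. x0^2 + x1^2 + x2^2 + x3^2 = 1}"
proof (intro equalityI subsetI)
  fix M assume "M \<in> carrier SU2"
  then have M: "M ** adjoint_mat M = mat 1" "det M = 1"
    by (auto simp: SU2_def)
  define a b c d where "a = M $ 1 $ 1" and "b = M $ 1 $ 2" and "c = M $ 2 $ 1" and "d = M $ 2 $ 2"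
  note abcd = a_def b_def c_def d_def
  have 1: "a * cnj a + b * cnj b = 1" and 2: "c * cnj a + d * cnj b = 0"
    using M(1) by (auto simp: abcd vec_eq_iff forall_2 matrix_matrix_mult_def sum_2 mat_def
        adjoint_mat_def)
  have 3: "a * d - b * c = 1"
    using M(2) by (simp add: abcd det_2)
  have c: "c = - cnj b" using 1 2 3 by algebra
  have d: "d = cnj a" using 1 2 3 by algebra
  have "complex_of_real ((Re a)^2 + (Im a)^2 + (Re b)^2 + (Im b)^2) = 1"
    using 1 by (simp add: complex_eq_iff power2_eq_square)
  then have "(Re a)^2 + (Im a)^2 + (Re b)^2 + (Im b)^2 = 1"
    by (simp only: of_real_eq_1_iff)
  moreover have "M = quat (Re a) (Im a) (Re b) (Im b)"
    using c d by (simp add: abcd quat_def vec_eq_iff forall_2 complex_eq_iff)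
  ultimately show "M \<in> {quat x0 x1 x2 x3 | x0 x1 x2 x3. x0^2 + x1^2 + x2^2 + x3^2 = 1}"
    by blast
next
  fix M assume "M \<in> {quat x0 x1 x2 x3 | x0 x1 x2 x3. x0^2 + x1^2 + x2^2 + x3^2 = 1}"
  then show "M \<in> carrier SU2"
    by (auto simp: SU2_def quat_def vec_eq_iff forall_2 matrix_matrix_mult_def sum_2 mat_def
        adjoint_mat_def det_2 complex_eq_iff power2_eq_square)
qed

lemma adjoint_mat_mult: "adjoint_mat (M ** N) = adjoint_mat N ** adjoint_mat M"
  by (simp add: adjoint_mat_def matrix_matrix_mult_def vec_eq_iff mult.commute)

lemma group_SU2: "group SU2"
proof (rule groupI)
  fix M N assume "M \<in> carrier SU2" "N \<in> carrier SU2"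
  then have M: "M ** adjoint_mat M = mat 1" "det M = 1"
    and N: "N ** adjoint_mat N = mat 1" "det N = 1"
    by (auto simp: SU2_def)
  have "(M ** N) ** adjoint_mat (M ** N) = M ** (N ** adjoint_mat N) ** adjoint_mat M"
    by (simp add: adjoint_mat_mult matrix_mul_assoc)
  then show "M \<otimes>\<^bsub>SU2\<^esub> N \<in> carrier SU2"
    using M N by (simp add: SU2_def det_mul)
next
  fix M assume "M \<in> carrier SU2"
  then have M: "M ** adjoint_mat M = mat 1" "det M = 1"
    by (auto simp: SU2_def)
  have inv: "adjoint_mat M ** M = mat 1"
    using M(1) matrix_left_right_inverse by blast
  moreover have "det (adjoint_mat M) = 1"
    using arg_cong[OF inv, of det] M(2) by (simp add: det_mul)
  moreover have "adjoint_mat (adjoint_mat M) = M"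
    by (simp add: adjoint_mat_def vec_eq_iff)
  ultimately show "\<exists>N\<in>carrier SU2. N \<otimes>\<^bsub>SU2\<^esub> M = \<one>\<^bsub>SU2\<^esub>"
    by (auto simp: SU2_def intro!: exI[of _ "adjoint_mat M"])
next
  have "adjoint_mat (mat 1 :: complex^2^2) = mat 1"
    by (auto simp: adjoint_mat_def mat_def vec_eq_iff)
  then show "\<one>\<^bsub>SU2\<^esub> \<in> carrier SU2"
    by (simp add: SU2_def)
qed (simp_all add: SU2_def matrix_mul_assoc)

definition imag_part :: "complex^2^2 \<Rightarrow> real^3" where
  "imag_part M = vector [Im (M $ 1 $ 1), Re (M $ 1 $ 2), Im (M $ 1 $ 2)]"

lemma imag_part_quat: "imag_part (quat x0 x1 x2 x3) = vector [x1, x2, x3]"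
  by (simp add: imag_part_def quat_def)

definition irreducible_rep :: "('g, 'b) monoid_scheme \<Rightarrow> ('g \<Rightarrow> complex^2^2) \<Rightarrow> bool" where
  "irreducible_rep G \<rho> \<longleftrightarrow>
     (\<forall>V. vec.subspace V \<and> (\<forall>x\<in>carrier G. \<forall>v\<in>V. \<rho> x *v v \<in> V) \<longrightarrow> V = {0} \<or> V = UNIV)"

definition traceless_rep :: "nat \<Rightarrow> int \<Rightarrow> (generator word set \<Rightarrow> complex^2^2) \<Rightarrow> bool" where
  "traceless_rep p q \<rho> \<longleftrightarrow>
     \<rho> \<in> hom (knot_group p q) SU2 \<and> (\<forall>m\<in>meridians p q. trace (\<rho> m) = 0)"

definition irred_traceless_reps :: "nat \<Rightarrow> int \<Rightarrow> (generator word set \<Rightarrow> complex^2^2) set" where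
  "irred_traceless_reps p q = {\<rho>. traceless_rep p q \<rho> \<and> irreducible_rep (knot_group p q) \<rho>}"

text \<open>
  Values outside the carrier of the group are ignored, so representations that differ only there
  are identified.
\<close>

definition conj_reps :: "('g, 'b) monoid_scheme \<Rightarrow> ('g \<Rightarrow> complex^2^2) rel" where
  "conj_reps G = {(\<rho>, \<sigma>). \<exists>g\<in>carrier SU2.
     \<forall>x\<in>carrier G. \<sigma> x = g \<otimes>\<^bsub>SU2\<^esub> \<rho> x \<otimes>\<^bsub>SU2\<^esub> inv\<^bsub>SU2\<^esub> g}"

definition irred_traceless_characters ::
    "nat \<Rightarrow> int \<Rightarrow> (generator word set \<Rightarrow> complex^2^2) set set" where
  "irred_traceless_characters p q =
     irred_traceless_reps p q //
       (conj_reps (knot_group p q) \<inter> irred_traceless_reps p q \<times> irred_traceless_reps p q)"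

definition Pin2 :: "(complex^2^2) set" where
  "Pin2 = {quat (cos \<phi>) (sin \<phi>) 0 0 | \<phi>. True} \<union>
          {quat 0 0 1 0 ** quat (cos \<phi>) (sin \<phi>) 0 0 | \<phi>. True}"

definition binary_dihedral :: "('g, 'b) monoid_scheme \<Rightarrow> ('g \<Rightarrow> complex^2^2) \<Rightarrow> bool" where
  "binary_dihedral G \<rho> \<longleftrightarrow>
     (\<exists>g\<in>carrier SU2. \<forall>x\<in>carrier G. g \<otimes>\<^bsub>SU2\<^esub> \<rho> x \<otimes>\<^bsub>SU2\<^esub> inv\<^bsub>SU2\<^esub> g \<in> Pin2)"

definition meridian_angle :: "nat \<Rightarrow> int \<Rightarrow> (generator word set \<Rightarrow> complex^2^2) \<Rightarrow> real" where
  "meridian_angle p q \<rho> =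
     arccos (imag_part (\<rho> (gen_class p q GenA)) \<bullet> imag_part (\<rho> (gen_class p q GenB)))"

section \<open>The traceless Riley polynomial\<close>

text \<open>Matrices have entries in the polynomial ring over the complex numbers in the variable \<open>u\<close>.\<close>

fun riley_gen :: "complex \<Rightarrow> generator \<Rightarrow> complex poly^2^2" where
  "riley_gen s GenA = vector [vector [[:s:], 1], vector [0, [:inverse s:]]]"
| "riley_gen s GenB = vector [vector [[:s:], 0], vector [- [:0, 1:], [:inverse s:]]]"

definition riley_word :: "complex \<Rightarrow> generator word \<Rightarrow> complex poly^2^2" where
  "riley_word s w =
     foldr (\<lambda>(g, e) M. (if e then riley_gen s g else matrix_inv (riley_gen s g)) ** M) w (mat 1)"

definition riley_poly :: "nat \<Rightarrow> int \<Rightarrow> complex \<Rightarrow> complex poly" where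
  "riley_poly p q s = (let W = riley_word s (two_bridge_word p q) in
     W $ 1 $ 1 + [:inverse s - s:] * W $ 1 $ 2)"

definition traceless_riley :: "nat \<Rightarrow> int \<Rightarrow> complex poly" where
  "traceless_riley p q =
     smult (inverse (lead_coeff (riley_poly p q \<i>))) (riley_poly p q \<i>)"

end

theory Submission
  imports Defs
begin

text \<open>
  A pair of trace-zero unit quaternions at angle \<open>\<phi>\<close> is conjugate to \<open>(j, j exp(i \<phi>))\<close>, which lies
  in \<open>Pin(2)\<close>; hence every traceless representation is binary dihedral and is determined up to
  conjugacy by its meridian-pair angle. Since \<open>a\<inverse> = - a\<close> and \<open>b\<inverse> = - b\<close> there, the word \<open>w\<close> becomes
  \<open>\<plusminus> (a b) ^ n\<close> with \<open>p = 2 n + 1\<close>, whatever \<open>q\<close> is, and on the normal form \<open>w a = b w\<close> reads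
  \<open>exp(i p \<phi>) = 1\<close>. The angle \<open>0\<close> is the reducible solution; the other solutions in \<open>[0, \<pi>]\<close> are
  \<open>2 \<pi> k / p\<close> for \<open>1 \<le> k \<le> n\<close>. The same collapse turns Riley's matrix into \<open>\<plusminus> R ^ n\<close> with \<open>det R = 1\<close>
  and \<open>tr R = - 2 - u\<close>, so by Cayley-Hamilton its normalization \<open>P\<^sub>n\<close> satisfies
  \<open>P\<^sub>n\<^sub>+\<^sub>2 = (u + 2) P\<^sub>n\<^sub>+\<^sub>1 - P\<^sub>n\<close>, and \<open>P\<^sub>n (2 cos 2x - 2) sin x = sin ((2 n + 1) x)\<close> exhibits all \<open>n\<close> roots.
\<close>

no_notation fps_nth (infixl \<open>$\<close> 75)

section \<open>Homomorphisms out of a presented group\<close>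

text \<open>The homomorphism on the free group induced by \<open>f\<close>, computed on unreduced
  words. The fold has the same shape as in \<open>riley_word\<close>, so
  \<open>foldr_alternating\<close> applies to both.\<close>

definition word_eval :: "('b, 'c) monoid_scheme \<Rightarrow> ('g \<Rightarrow> 'b) \<Rightarrow> 'g word \<Rightarrow> 'b" where
  "word_eval H f w =
     foldr (\<lambda>(g, e) M. (if e then f g else inv\<^bsub>H\<^esub> f g) \<otimes>\<^bsub>H\<^esub> M) w \<one>\<^bsub>H\<^esub>"

lemma word_eval_Nil [simp]: "word_eval H f [] = \<one>\<^bsub>H\<^esub>"
  by (simp add: word_eval_def)

lemma word_eval_Cons [simp]:
  "word_eval H f ((g, e) # w) = (if e then f g else inv\<^bsub>H\<^esub> f g) \<otimes>\<^bsub>H\<^esub> word_eval H f w"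
  by (simp add: word_eval_def)

context group
begin

lemma word_eval_closed:
  assumes "range f \<subseteq> carrier G"
  shows "word_eval G f w \<in> carrier G"
proof (induction w)
  case (Cons l w)
  then show ?case using assms by (cases l) (auto simp: range_subsetD)
qed simp

lemma word_eval_append:
  assumes "range f \<subseteq> carrier G"
  shows "word_eval G f (v @ w) = word_eval G f v \<otimes> word_eval G f w"
proof (induction v)
  case Nil
  then show ?case by (simp add: word_eval_closed[OF assms])
next
  case (Cons l v)
  obtain g e where l: "l = (g, e)" by (cases l)
  have "f g \<in> carrier G" using assms by auto
  then show ?case using Cons by (simp add: l word_eval_closed[OF assms] m_assoc)
qed

text \<open>Each generating move of \<open>pres_eq\<close> inserts or deletes a factor whose value
  is the identity.\<close>

lemma word_eval_pres_eq:
  assumes f: "range f \<subseteq> carrier G" and R: "\<And>r. r \<in> R \<Longrightarrow> word_eval G f r = \<one>"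
    and "pres_eq R v w"
  shows "word_eval G f v = word_eval G f w"
  using assms(3)
proof (induction rule: pres_eq.induct)
  case (cancel u g e v)
  have "f g \<in> carrier G" using f by auto
  then show ?case
    using word_eval_closed[OF f, of v]
    by (simp add: word_eval_append[OF f] m_assoc[symmetric])
next
  case (relator r u v)
  then show ?case
    using word_eval_closed[OF f] by (simp add: word_eval_append[OF f] R)
qed auto

lemma word_eval_word_inv:
  assumes f: "range f \<subseteq> carrier G"
  shows "word_eval G f (word_inv w) = inv (word_eval G f w)"
proof -
  have "word_eval G f (word_inv w) \<otimes> word_eval G f w = word_eval G f (word_inv w @ w)"
    by (simp add: word_eval_append[OF f])
  also have "\<dots> = \<one>"
    \<comment> \<open>The empty relator set suffices here: \<open>word_inv w @ w\<close> reduces to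
      the empty word by free cancellation.\<close>
    using word_eval_pres_eq[OF f, of "{}"] pres_eq_word_inv by fastforce
  finally show ?thesis
    by (simp add: inv_equality word_eval_closed[OF f])
qed

end

lemma pres_class_in_carrier [simp]: "pres_class R w \<in> carrier (presented_group R)"
  by (simp add: presented_group_def)

lemma carrier_presented_group: "carrier (presented_group R) = range (pres_class R)"
  by (simp add: presented_group_def)

lemma one_presented_group: "\<one>\<^bsub>presented_group R\<^esub> = pres_class R []"
  by (simp add: presented_group_def)

lemma inv_pres_class: "inv\<^bsub>presented_group R\<^esub> (pres_class R w) = pres_class R (word_inv w)"
  by (intro group.inv_equality)
     (auto simp: group_presented_group pres_class_mult pres_class_eq_iff pres_eq_word_inv
        one_presented_group)

text \<open>Turns a relator of the form \<open>u @ word_inv v\<close> back into an equation; it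
  recovers \<open>w a = b w\<close> in the knot group.\<close>

lemma pres_class_relation:
  assumes "u @ word_inv v \<in> R"
  shows "pres_class R u = pres_class R v"
proof -
  interpret group "presented_group R" by (rule group_presented_group)
  have "pres_class R u \<otimes>\<^bsub>presented_group R\<^esub> inv\<^bsub>presented_group R\<^esub> (pres_class R v)
      = \<one>\<^bsub>presented_group R\<^esub>"
    using pres_eq.relator[OF assms, of "[]" "[]"]
    by (simp add: inv_pres_class pres_class_mult one_presented_group pres_class_eq_iff)
  then have "pres_class R u \<otimes>\<^bsub>presented_group R\<^esub> inv\<^bsub>presented_group R\<^esub> (pres_class R v)
      = pres_class R v \<otimes>\<^bsub>presented_group R\<^esub> inv\<^bsub>presented_group R\<^esub> (pres_class R v)"
    by simp
  then show ?thesis by (subst (asm) right_cancel) (simp_all del: right_cancel)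
qed

lemma hom_pres_class:
  assumes "group H" and \<rho>: "\<rho> \<in> hom (presented_group R) H"
  shows "\<rho> (pres_class R w) = word_eval H (\<lambda>g. \<rho> (pres_class R [(g, True)])) w"
proof (induction w)
  interpret group_hom "presented_group R" H \<rho>
    using assms by (simp add: group_hom_def group_hom_axioms_def group_presented_group)
  {
    case Nil
    show ?case using hom_one by (simp add: one_presented_group)
  next
    case (Cons l w)
    obtain g e where l: "l = (g, e)" by (cases l)
    have "pres_class R (l # w) = pres_class R [l] \<otimes>\<^bsub>presented_group R\<^esub> pres_class R w"
      by (simp add: pres_class_mult)
    then have "\<rho> (pres_class R (l # w)) = \<rho> (pres_class R [l]) \<otimes>\<^bsub>H\<^esub> \<rho> (pres_class R w)"
      by simp
    moreover have "\<rho> (pres_class R [(g, False)]) = inv\<^bsub>H\<^esub> \<rho> (pres_class R [(g, True)])"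
      using hom_inv[of "pres_class R [(g, True)]"] by (simp add: inv_pres_class word_inv_def)
    ultimately show ?case using Cons by (simp add: l)
  }
qed

text \<open>Universal property of a presentation: by \<open>word_eval_pres_eq\<close> the value does
  not depend on the word chosen to represent a class.\<close>

lemma presented_group_lift:
  assumes H: "group H" and f: "range f \<subseteq> carrier H"
    and R: "\<And>r. r \<in> R \<Longrightarrow> word_eval H f r = \<one>\<^bsub>H\<^esub>"
  obtains \<rho> where "\<rho> \<in> hom (presented_group R) H" "\<And>w. \<rho> (pres_class R w) = word_eval H f w"
proof
  interpret H: group H by fact
  define \<rho> where "\<rho> = (\<lambda>X. word_eval H f (SOME w. X = pres_class R w))"
  show *: "\<rho> (pres_class R w) = word_eval H f w" for w
  proof -
    have "pres_class R w = pres_class R (SOME v. pres_class R w = pres_class R v)"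
      by (rule someI[of _ w]) simp
    then show ?thesis
      unfolding \<rho>_def by (metis H.word_eval_pres_eq[OF f R] pres_class_eq_iff)
  qed
  show "\<rho> \<in> hom (presented_group R) H"
    by (auto simp: hom_def carrier_presented_group * H.word_eval_closed[OF f] pres_class_mult
        H.word_eval_append[OF f])
qed

lemma hom_conjugate:
  assumes "group H" and "\<rho> \<in> hom G H" and "g \<in> carrier H"
  shows "(\<lambda>x. g \<otimes>\<^bsub>H\<^esub> \<rho> x \<otimes>\<^bsub>H\<^esub> inv\<^bsub>H\<^esub> g) \<in> hom G H"
proof -
  interpret H: group H by fact
  have "g \<otimes>\<^bsub>H\<^esub> (x \<otimes>\<^bsub>H\<^esub> y) \<otimes>\<^bsub>H\<^esub> inv\<^bsub>H\<^esub> g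
      = g \<otimes>\<^bsub>H\<^esub> x \<otimes>\<^bsub>H\<^esub> inv\<^bsub>H\<^esub> g \<otimes>\<^bsub>H\<^esub> (g \<otimes>\<^bsub>H\<^esub> y \<otimes>\<^bsub>H\<^esub> inv\<^bsub>H\<^esub> g)"
    if "x \<in> carrier H" "y \<in> carrier H" for x y
  proof -
    have "inv\<^bsub>H\<^esub> g \<otimes>\<^bsub>H\<^esub> (g \<otimes>\<^bsub>H\<^esub> z) = z" if "z \<in> carrier H" for z
      using that assms(3) by (simp flip: H.m_assoc)
    then show ?thesis
      using that assms(3) by (simp add: H.m_assoc)
  qed
  then show ?thesis
    using assms(2,3) by (auto simp: hom_def Pi_iff)
qed

section \<open>Pairs of trace-zero unit quaternions\<close>

lemma mult_SU2 [simp]: "M \<otimes>\<^bsub>SU2\<^esub> N = M ** N"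
  by (simp add: SU2_def)

lemma one_SU2 [simp]: "\<one>\<^bsub>SU2\<^esub> = mat 1"
  by (simp add: SU2_def)

lemma quat_eq_iff:
  "quat a b c d = quat a' b' c' d' \<longleftrightarrow> a = a' \<and> b = b' \<and> c = c' \<and> d = d'"
  by (auto simp: quat_def vec_eq_iff forall_2 complex_eq_iff)

lemma quat_mult:
  "quat a b c d ** quat a' b' c' d' =
     quat (a * a' - b * b' - c * c' - d * d') (a * b' + b * a' + c * d' - d * c')
          (a * c' - b * d' + c * a' + d * b') (a * d' + b * c' - c * b' + d * a')"
  by (simp add: quat_def vec_eq_iff forall_2 matrix_matrix_mult_def sum_2 complex_eq_iff
      algebra_simps)

lemma mat_1_eq_quat: "mat 1 = quat 1 0 0 0"
  by (simp add: quat_def vec_eq_iff forall_2 mat_def complex_eq_iff)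

lemma minus_quat: "- quat a b c d = quat (- a) (- b) (- c) (- d)"
  by (simp add: quat_def vec_eq_iff forall_2 complex_eq_iff)

lemma trace_quat: "trace (quat a b c d) = complex_of_real (2 * a)"
  by (simp add: trace_def sum_2 quat_def complex_eq_iff)

lemma quat_in_SU2: "quat a b c d \<in> carrier SU2 \<longleftrightarrow> a\<^sup>2 + b\<^sup>2 + c\<^sup>2 + d\<^sup>2 = 1"
  by (auto simp: carrier_SU2 quat_eq_iff)

lemma inv_quat:
  assumes "a\<^sup>2 + b\<^sup>2 + c\<^sup>2 + d\<^sup>2 = 1"
  shows "inv\<^bsub>SU2\<^esub> (quat a b c d) = quat a (- b) (- c) (- d)"
  using assms
  by (intro group.inv_equality[OF group_SU2])
     (auto simp: quat_in_SU2 quat_mult mat_1_eq_quat quat_eq_iff power2_eq_square algebra_simps)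

lemma traceless_SU2E:
  assumes "M \<in> carrier SU2" "trace M = 0"
  obtains x y z where "M = quat 0 x y z" "x\<^sup>2 + y\<^sup>2 + z\<^sup>2 = 1"
proof -
  obtain a x y z where M: "M = quat a x y z" and 1: "a\<^sup>2 + x\<^sup>2 + y\<^sup>2 + z\<^sup>2 = 1"
    using assms(1) by (auto simp: carrier_SU2)
  have "a = 0" using assms(2) by (simp add: M trace_quat)
  with M 1 show thesis by (intro that) auto
qed

text \<open>Clearing the inverse leaves an intertwining relation that is linear in \<open>g\<close>,
  so a solution can be found first and normalized afterwards.\<close>

lemma SU2_conj_iff:
  assumes "g \<in> carrier SU2" "M \<in> carrier SU2"
  shows "g ** M ** inv\<^bsub>SU2\<^esub> g = N \<longleftrightarrow> g ** M = N ** g"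
proof -
  interpret group SU2 by (rule group_SU2)
  have 1: "inv\<^bsub>SU2\<^esub> g ** g = mat 1" "g ** inv\<^bsub>SU2\<^esub> g = mat 1"
    using l_inv[OF assms(1)] r_inv[OF assms(1)] by simp_all
  show ?thesis
  proof
    assume "g ** M ** inv\<^bsub>SU2\<^esub> g = N"
    then have "N ** g = g ** M ** (inv\<^bsub>SU2\<^esub> g ** g)"
      by (simp add: matrix_mul_assoc)
    then show "g ** M = N ** g" by (simp add: 1)
  next
    assume "g ** M = N ** g"
    then have "g ** M ** inv\<^bsub>SU2\<^esub> g = N ** (g ** inv\<^bsub>SU2\<^esub> g)"
      by (simp add: matrix_mul_assoc)
    then show "g ** M ** inv\<^bsub>SU2\<^esub> g = N" by (simp add: 1)
  qed
qed

lemma trace_SU2_conj: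
  assumes "g \<in> carrier SU2"
  shows "trace (g ** M ** inv\<^bsub>SU2\<^esub> g) = trace M"
proof -
  have "inv\<^bsub>SU2\<^esub> g ** g = mat 1"
    using group.l_inv[OF group_SU2 assms] by simp
  then show ?thesis
    by (simp add: trace_mul_sym[of "g ** M"] matrix_mul_assoc)
qed

text \<open>The real part of a product of imaginary quaternions is minus their inner product, and
  the trace is twice the real part. Through the trace the angle becomes a conjugation
  invariant.\<close>

lemma imag_part_inner:
  assumes "M \<in> carrier SU2" "trace M = 0" "N \<in> carrier SU2" "trace N = 0"
  shows "imag_part M \<bullet> imag_part N = - Re (trace (M ** N)) / 2"
proof -
  obtain x y z where M: "M = quat 0 x y z" using traceless_SU2E assms by metis
  obtain x' y' z' where N: "N = quat 0 x' y' z'" using traceless_SU2E assms by metis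
  show ?thesis
    by (simp add: M N imag_part_quat quat_mult trace_quat inner_vec_def sum_3)
qed

lemma imag_part_inner_bound:
  assumes "M \<in> carrier SU2" "trace M = 0" "N \<in> carrier SU2" "trace N = 0"
  shows "\<bar>imag_part M \<bullet> imag_part N\<bar> \<le> 1"
proof -
  have 1: "norm (imag_part M) = 1" if M: "M \<in> carrier SU2" "trace M = 0" for M
    by (rule traceless_SU2E[OF M])
       (simp add: imag_part_quat norm_eq_sqrt_inner inner_vec_def sum_3 power2_eq_square)
  show ?thesis
    using Cauchy_Schwarz_ineq2[of "imag_part M" "imag_part N"] 1 assms by simp
qed

text \<open>Intertwining relations are homogeneous, so a nonzero quaternion may be divided by its
  norm. One \<open>g\<close> serves all \<open>M\<close> and \<open>N\<close>, which allows two
  relations to be transported at once.\<close>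

lemma intertwiner_normalize:
  assumes "a \<noteq> 0 \<or> b \<noteq> 0 \<or> c \<noteq> 0 \<or> d \<noteq> 0"
  shows "\<exists>g\<in>carrier SU2. \<forall>M N. quat a b c d ** M = N ** quat a b c d \<longrightarrow> g ** M = N ** g"
proof (intro bexI allI impI)
  let ?n = "a\<^sup>2 + b\<^sup>2 + c\<^sup>2 + d\<^sup>2" and ?Q = "quat a b c d"
  let ?g = "(1 / sqrt ?n) *\<^sub>R ?Q"
  have pos: "?n > 0"
    using assms by (smt (verit) zero_less_power2 zero_le_power2)
  have "?g = quat (a / sqrt ?n) (b / sqrt ?n) (c / sqrt ?n) (d / sqrt ?n)"
    by (simp add: quat_def vec_eq_iff forall_2 complex_eq_iff)
  moreover have "(a / sqrt ?n)\<^sup>2 + (b / sqrt ?n)\<^sup>2 + (c / sqrt ?n)\<^sup>2 + (d / sqrt ?n)\<^sup>2 = ?n / (sqrt ?n)\<^sup>2"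
    by (simp only: power_divide add_divide_distrib)
  moreover have "?n / (sqrt ?n)\<^sup>2 = 1"
    using pos by (simp only: real_sqrt_pow2 less_imp_le divide_self_if) simp
  ultimately show "?g \<in> carrier SU2"
    by (simp only: quat_in_SU2)
  show "?g ** M = N ** ?g" if "?Q ** M = N ** ?Q" for M N
    using that by (metis matrix_scalar_ac scalar_matrix_assoc)
qed

text \<open>The pair \<open>(j, j exp(i \<phi>))\<close>: since \<open>j i = - k\<close>, the second
  entry is \<open>cos \<phi> j - sin \<phi> k\<close>.\<close>

definition std_pair :: "real \<Rightarrow> generator \<Rightarrow> complex^2^2" where
  "std_pair \<phi> = case_generator (quat 0 0 1 0) (quat 0 0 (cos \<phi>) (- sin \<phi>))"

lemma std_pair_simps [simp]:
  "std_pair \<phi> GenA = quat 0 0 1 0" "std_pair \<phi> GenB = quat 0 0 (cos \<phi>) (- sin \<phi>)"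
  by (simp_all add: std_pair_def)

lemma std_pair_in_SU2: "range (std_pair \<phi>) \<subseteq> carrier SU2"
proof -
  have "std_pair \<phi> x \<in> carrier SU2" for x by (cases x) (auto simp: quat_in_SU2)
  then show ?thesis by auto
qed

text \<open>
  For any \<open>A\<close> with \<open>A\<^sup>2 = - 1\<close>, the quaternion \<open>1 - j A\<close> intertwines \<open>A\<close> with \<open>j\<close>; it vanishes only
  for \<open>A = - j\<close>.
\<close>

lemma conj_to_j:
  assumes "x\<^sup>2 + y\<^sup>2 + z\<^sup>2 = 1"
  obtains g where "g \<in> carrier SU2" "g ** quat 0 x y z = quat 0 0 1 0 ** g"
proof (cases "x = 0 \<and> y = - 1 \<and> z = 0")
  \<comment> \<open>Here \<open>A = - j\<close>, and conjugation by \<open>i\<close> negates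
    \<open>j\<close>.\<close>
  case True
  then show thesis
    by (intro that[of "quat 0 1 0 0"]) (auto simp: quat_in_SU2 quat_mult quat_eq_iff)
next
  case False
  \<comment> \<open>These are the coordinates of \<open>1 - j A\<close>.\<close>
  then have "1 + y \<noteq> 0 \<or> - z \<noteq> 0 \<or> 0 \<noteq> (0::real) \<or> x \<noteq> 0" by auto
  then obtain g where g: "g \<in> carrier SU2"
    "\<forall>M N. quat (1 + y) (- z) 0 x ** M = N ** quat (1 + y) (- z) 0 x \<longrightarrow> g ** M = N ** g"
    using intertwiner_normalize by blast
  moreover have "quat (1 + y) (- z) 0 x ** quat 0 x y z = quat 0 0 1 0 ** quat (1 + y) (- z) 0 x"
    using assms by (auto simp: quat_mult quat_eq_iff power2_eq_square algebra_simps)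
  ultimately show thesis using that by blast
qed

text \<open>The quaternions \<open>a + b j\<close> commute with \<open>j\<close> and rotate about
  its axis. Source and target have the same \<open>j\<close>-coordinate, so they lie on one circle
  around that axis.\<close>

lemma conj_fixing_j:
  assumes "x\<^sup>2 + y\<^sup>2 + z\<^sup>2 = 1" "y = cos \<phi>"
  obtains h where "h \<in> carrier SU2" "h ** quat 0 0 1 0 = quat 0 0 1 0 ** h"
    "h ** quat 0 x y z = quat 0 0 (cos \<phi>) (- sin \<phi>) ** h"
proof -
  note that_h = that
  have s: "x\<^sup>2 + z\<^sup>2 = (sin \<phi>)\<^sup>2"
    using assms by (simp add: sin_squared_eq)
  \<comment> \<open>The two equations are the \<open>i\<close>- and \<open>k\<close>-coordinates of
    the intertwining relation for \<open>a + b j\<close>. By \<open>s\<close> this homogeneous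
    linear system in \<open>(a, b)\<close> has determinant zero.\<close>
  have *: thesis if "a \<noteq> 0 \<or> b \<noteq> 0"
    "a * x + b * z = sin \<phi> * b" "a * z - b * x = - sin \<phi> * a" for a b
  proof -
    from that(1) have "a \<noteq> 0 \<or> 0 \<noteq> (0::real) \<or> b \<noteq> 0 \<or> 0 \<noteq> (0::real)" by auto
    then obtain h where h: "h \<in> carrier SU2"
      "\<forall>M N. quat a 0 b 0 ** M = N ** quat a 0 b 0 \<longrightarrow> h ** M = N ** h"
      using intertwiner_normalize by blast
    moreover have "quat a 0 b 0 ** quat 0 0 1 0 = quat 0 0 1 0 ** quat a 0 b 0"
      by (simp add: quat_mult)
    moreover have "quat a 0 b 0 ** quat 0 x y z = quat 0 0 (cos \<phi>) (- sin \<phi>) ** quat a 0 b 0"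
      using that(2,3) assms(2) by (simp add: quat_mult quat_eq_iff)
    ultimately show thesis using assms(1) that_h by blast
  qed
  show thesis
  \<comment> \<open>The second equation suggests the solution \<open>(x, sin \<phi> + z)\<close>. If
    that vanishes, the source already equals the target and \<open>h = 1\<close> works.\<close>
  proof (cases "x = 0 \<and> sin \<phi> + z = 0")
    case True
    then show thesis by (intro *[of 1 0]) auto
  next
    case False
    then show thesis
      using s by (intro *[of x "sin \<phi> + z"]) (auto simp: power2_eq_square algebra_simps)
  qed
qed

text \<open>Two stages: \<open>g\<close> moves \<open>A\<close> to \<open>j\<close>, then
  \<open>h\<close> rotates about \<open>j\<close>. The \<open>j\<close>-coordinate of the moved
  \<open>B\<close> is fixed by \<open>trace (A ** B)\<close>, hence equals
  \<open>cos \<phi>\<close>.\<close>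

lemma traceless_pair_normal_form:
  assumes A: "A \<in> carrier SU2" "trace A = 0" and B: "B \<in> carrier SU2" "trace B = 0"
  defines "\<phi> \<equiv> arccos (imag_part A \<bullet> imag_part B)"
  obtains g where "g \<in> carrier SU2"
    "g ** A ** inv\<^bsub>SU2\<^esub> g = std_pair \<phi> GenA" "g ** B ** inv\<^bsub>SU2\<^esub> g = std_pair \<phi> GenB"
proof -
  interpret group SU2 by (rule group_SU2)
  have mult: "M ** N \<in> carrier SU2" if "M \<in> carrier SU2" "N \<in> carrier SU2" for M N
    using m_closed[OF that] by simp
  obtain g where g: "g \<in> carrier SU2" "g ** A = quat 0 0 1 0 ** g"
    using traceless_SU2E[OF A] conj_to_j by metis
  define B' where "B' = g ** B ** inv\<^bsub>SU2\<^esub> g"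
  have gA: "g ** A ** inv\<^bsub>SU2\<^esub> g = quat 0 0 1 0"
    using SU2_conj_iff[OF g(1) A(1)] g(2) by simp
  have B': "B' \<in> carrier SU2" "trace B' = 0"
    using g(1) B by (auto simp: B'_def trace_SU2_conj intro!: mult)
  obtain x y z where xyz: "B' = quat 0 x y z" "x\<^sup>2 + y\<^sup>2 + z\<^sup>2 = 1"
    by (rule traceless_SU2E[OF B'])
  have "inv\<^bsub>SU2\<^esub> g ** g = mat 1" using l_inv[OF g(1)] by simp
  moreover have "(g ** A ** inv\<^bsub>SU2\<^esub> g) ** B' = g ** A ** (inv\<^bsub>SU2\<^esub> g ** g) ** B ** inv\<^bsub>SU2\<^esub> g"
    by (simp add: B'_def matrix_mul_assoc)
  ultimately have "(g ** A ** inv\<^bsub>SU2\<^esub> g) ** B' = g ** (A ** B) ** inv\<^bsub>SU2\<^esub> g"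
    by (simp add: matrix_mul_assoc)
  then have "trace (quat 0 0 1 0 ** B') = trace (A ** B)"
    using trace_SU2_conj[OF g(1), of "A ** B"] gA by simp
  then have "y = imag_part A \<bullet> imag_part B"
    by (simp add: imag_part_inner[OF A B] xyz(1) quat_mult trace_quat flip: \<open>_ = trace (A ** B)\<close>)
  then have "y = cos \<phi>"
    using imag_part_inner_bound[OF A B] by (simp add: \<phi>_def cos_arccos_abs)
  then obtain h where h: "h \<in> carrier SU2" "h ** quat 0 0 1 0 = quat 0 0 1 0 ** h"
    "h ** B' = quat 0 0 (cos \<phi>) (- sin \<phi>) ** h"
    using conj_fixing_j[OF xyz(2)] xyz(1) by metis
  have B'g: "g ** B = B' ** g"
    using SU2_conj_iff[OF g(1) B(1), of B'] by (simp add: B'_def)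
  show thesis
  proof (rule that[of "h ** g"])
    show hg: "h ** g \<in> carrier SU2" by (rule mult) fact+
    show "h ** g ** A ** inv\<^bsub>SU2\<^esub> (h ** g) = std_pair \<phi> GenA"
      unfolding SU2_conj_iff[OF hg A(1)] using g(2) h(2) by (metis matrix_mul_assoc std_pair_simps)
    show "h ** g ** B ** inv\<^bsub>SU2\<^esub> (h ** g) = std_pair \<phi> GenB"
      unfolding SU2_conj_iff[OF hg B(1)] using B'g h(3) by (metis matrix_mul_assoc std_pair_simps)
  qed
qed

section \<open>Collapse of the exponents in alternating words\<close>

lemma matrix_mult_minus:
  fixes A :: "'a::comm_ring_1^'n^'m" and B :: "'a^'l^'n"
  shows "(- A) ** B = - (A ** B)" "A ** (- B) = - (A ** B)"
  by (simp_all add: matrix_matrix_mult_def vec_eq_iff sum_negf)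

text \<open>
  At trace zero the inverse of each generator is its negative, so the signs \<open>\<epsilon> i\<close>, and with them
  the dependence on \<open>q\<close>, collapse into a single overall sign.
\<close>

lemma foldr_alternating:
  fixes X X' :: "generator \<Rightarrow> 'a::comm_ring_1^'n^'n" and n :: nat and \<epsilon> :: "nat \<Rightarrow> bool"
  assumes X': "\<And>g. X' g = - X g"
  defines "P \<equiv> ((**) (X GenA ** X GenB) ^^ n) (mat 1)"
  defines "W \<equiv> foldr (\<lambda>(g, e) M. (if e then X g else X' g) ** M)
             (map (\<lambda>i. (if odd i then GenA else GenB, \<epsilon> i)) [1..<2 * n + 1]) (mat 1)"
  shows "W = P \<or> W = - P"
  unfolding P_def W_def
proof (induction n arbitrary: \<epsilon>)
  case (Suc n)
  let ?L = "\<lambda>\<epsilon> n. map (\<lambda>i. (if odd i then GenA else GenB, \<epsilon> i :: bool)) [1..<2 * n + 1]"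
  let ?E = "\<lambda>w. foldr (\<lambda>(g, e) M. (if e then X g else X' g) ** M) w (mat 1)"
  \<comment> \<open>Removing one pair of letters shifts the index by 2, which keeps the parity and
    replaces \<open>\<epsilon>\<close> by a shifted sign function.\<close>
  have "[1..<2 * Suc n + 1] = 1 # 2 # map (\<lambda>i. i + 2) [1..<2 * n + 1]"
    by (rule nth_equalityI) (auto simp: nth_Cons split: nat.split simp del: upt_Suc)
  then have "?L \<epsilon> (Suc n) = (GenA, \<epsilon> 1) # (GenB, \<epsilon> 2) # ?L (\<lambda>i. \<epsilon> (i + 2)) n"
    by (simp del: upt_Suc)
  then have "?E (?L \<epsilon> (Suc n)) = (if \<epsilon> 1 then X GenA else X' GenA)
      ** ((if \<epsilon> 2 then X GenB else X' GenB) ** ?E (?L (\<lambda>i. \<epsilon> (i + 2)) n))"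
    by (simp del: upt_Suc)
  also have "\<dots> = X GenA ** X GenB ** ?E (?L (\<lambda>i. \<epsilon> (i + 2)) n)
      \<or> \<dots> = - (X GenA ** X GenB ** ?E (?L (\<lambda>i. \<epsilon> (i + 2)) n))"
    by (simp add: X' matrix_mult_minus matrix_mul_assoc del: upt_Suc)
  finally show ?case
    using Suc[of "\<lambda>i. \<epsilon> (i + 2)"] by (auto simp: matrix_mult_minus simp del: upt_Suc)
qed simp

text \<open>Keeps only the alternation and the even length of the word; \<open>q\<close> survives
  solely in the unspecified signs \<open>\<epsilon>\<close>.\<close>

lemma two_bridge_word_odd:
  assumes "odd p"
  shows "\<exists>\<epsilon>. two_bridge_word p q =
    map (\<lambda>i. (if odd i then GenA else GenB, \<epsilon> i)) [1..<2 * ((p - 1) div 2) + 1]"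
proof -
  have "2 * ((p - 1) div 2) + 1 = p" using assms by (auto elim: oddE)
  then show ?thesis unfolding two_bridge_word_def by metis
qed

section \<open>Traceless representations of the knot group\<close>

text \<open>The word evaluates to \<open>\<plusminus> exp(i n \<phi>)\<close>, and moving it past
  \<open>j\<close> conjugates it. The relation therefore compares \<open>j exp(- i n \<phi>)\<close>
  with \<open>j exp(i (n + 1) \<phi>)\<close>.\<close>

lemma std_pair_relator:
  assumes "odd p"
  shows "word_eval SU2 (std_pair \<phi>) (two_bridge_relator p q) = mat 1 \<longleftrightarrow> cos (real p * \<phi>) = 1"
proof -
  interpret group SU2 by (rule group_SU2)
  define n where "n = (p - 1) div 2"
  have p: "p = 2 * n + 1" using assms by (auto simp: n_def elim: oddE)
  let ?E = "word_eval SU2 (std_pair \<phi>)"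
  let ?W = "?E (two_bridge_word p q)"
  note range = std_pair_in_SU2[of \<phi>]
  have inv: "inv\<^bsub>SU2\<^esub> std_pair \<phi> g = - std_pair \<phi> g" for g
    by (cases g) (auto simp: inv_quat minus_quat)
  define P where "P = ((**) (std_pair \<phi> GenA ** std_pair \<phi> GenB) ^^ n) (mat 1)"
  obtain \<epsilon> where w: "two_bridge_word p q =
      map (\<lambda>i. (if odd i then GenA else GenB, \<epsilon> i)) [1..<2 * n + 1]"
    unfolding n_def using two_bridge_word_odd[OF assms] by blast
  have WP: "?W = P \<or> ?W = - P"
    unfolding word_eval_def w P_def mult_SU2 one_SU2
    by (rule foldr_alternating) (rule inv)
  \<comment> \<open>The sign comes from
    \<open>j (j exp(i \<phi>)) = - exp(i \<phi>)\<close>.\<close>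
  have P: "((**) (std_pair \<phi> GenA ** std_pair \<phi> GenB) ^^ m) (mat 1)
      = quat ((- 1) ^ m * cos (real m * \<phi>)) ((- 1) ^ m * sin (real m * \<phi>)) 0 0" for m
    by (induction m)
       (auto simp: mat_1_eq_quat quat_mult quat_eq_iff cos_add sin_add algebra_simps)
  \<comment> \<open>The scalar \<open>s\<close> collects all signs; being nonzero, it cancels from
    both sides of the relation.\<close>
  obtain s where W: "?W = quat (s * cos (real n * \<phi>)) (s * sin (real n * \<phi>)) 0 0"
    and s: "s \<noteq> 0"
  proof -
    assume *: thesis if "?W = quat (s * cos (real n * \<phi>)) (s * sin (real n * \<phi>)) 0 0" "s \<noteq> 0" for s
    from WP show thesis
    proof
      assume "?W = P"
      then show thesis by (intro *[of "(- 1) ^ n"]) (simp_all add: P_def P del: std_pair_simps)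
    next
      assume "?W = - P"
      then show thesis by (intro *[of "- ((- 1) ^ n)"]) (simp_all add: P_def P minus_quat del: std_pair_simps)
    qed
  qed
  have "?E (two_bridge_relator p q) = mat 1
      \<longleftrightarrow> ?E (two_bridge_word p q @ [(GenA, True)]) = ?E ((GenB, True) # two_bridge_word p q)"
  proof -
    let ?u = "?E (two_bridge_word p q @ [(GenA, True)])"
      and ?v = "?E ([(GenB, True)] @ two_bridge_word p q)"
    have "?E (two_bridge_relator p q) = ?u \<otimes>\<^bsub>SU2\<^esub> inv\<^bsub>SU2\<^esub> ?v"
      unfolding two_bridge_relator_def word_eval_append[OF range, of "_ @ [_]"]
        word_eval_word_inv[OF range] ..
    moreover have "\<one>\<^bsub>SU2\<^esub> = ?u \<otimes>\<^bsub>SU2\<^esub> inv\<^bsub>SU2\<^esub> ?v \<longleftrightarrow> ?u = \<one>\<^bsub>SU2\<^esub> \<otimes>\<^bsub>SU2\<^esub> ?v"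
      by (intro inv_solve_right one_closed word_eval_closed[OF range])
    ultimately show ?thesis by auto
  qed
  also have "\<dots> \<longleftrightarrow> ?W ** std_pair \<phi> GenA = std_pair \<phi> GenB ** ?W"
    by (simp add: word_eval_append[OF range])
  also have "\<dots> \<longleftrightarrow> cos (real n * \<phi>) = cos (real (n + 1) * \<phi>) \<and> sin (real n * \<phi>) = - sin (real (n + 1) * \<phi>)"
  proof -
    have "?W ** std_pair \<phi> GenA = quat 0 0 (s * cos (real n * \<phi>)) (s * sin (real n * \<phi>))"
      by (simp add: W quat_mult)
    moreover have "std_pair \<phi> GenB ** ?W
        = quat 0 0 (s * cos (real (n + 1) * \<phi>)) (s * - sin (real (n + 1) * \<phi>))"
      by (simp add: W quat_mult quat_eq_iff cos_add sin_add algebra_simps)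
    ultimately show ?thesis
      using s by (simp only: quat_eq_iff mult_cancel_left) simp
  qed
  also have "\<dots> \<longleftrightarrow> cos (real p * \<phi>) = 1"
  proof -
    define a b where "a = real n * \<phi>" and "b = real (n + 1) * \<phi>"
    have "real p * \<phi> = a + b" by (simp add: p a_def b_def algebra_simps)
    moreover have "cos a = cos b \<and> sin a = - sin b \<longleftrightarrow> cos (a + b) = 1"
    proof
      assume "cos a = cos b \<and> sin a = - sin b"
      then show "cos (a + b) = 1"
        using sin_cos_squared_add[of b] by (simp add: cos_add power2_eq_square)
    next
      assume 1: "cos (a + b) = 1"
      then have "sin (a + b) = 0" using sin_cos_squared_add[of "a + b"] by simp
      then show "cos a = cos b \<and> sin a = - sin b"
        using 1 cos_diff[of "a + b" b] sin_diff[of "a + b" b] by simp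
    qed
    ultimately show ?thesis by (simp add: a_def b_def)
  qed
  finally show ?thesis .
qed

section \<open>Reduction of traceless representations to the normal form\<close>

lemma group_knot_group: "group (knot_group p q)"
  by (simp add: knot_group_def group_presented_group)

lemma gen_class_in_carrier [simp]: "gen_class p q g \<in> carrier (knot_group p q)"
  by (simp add: gen_class_def knot_group_def)

lemma hom_knot_group_word:
  assumes "\<rho> \<in> hom (knot_group p q) SU2"
  shows "\<rho> (pres_class {two_bridge_relator p q} w)
    = word_eval SU2 (\<lambda>g. \<rho> (gen_class p q g)) w"
  using hom_pres_class[OF group_SU2, of \<rho> "{two_bridge_relator p q}" w] assms
  by (simp add: knot_group_def gen_class_def)

lemma trace_inv_SU2:
  assumes "M \<in> carrier SU2" "trace M = 0"
  shows "trace (inv\<^bsub>SU2\<^esub> M) = 0"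
  by (rule traceless_SU2E[OF assms]) (simp add: inv_quat trace_quat)

text \<open>The defining relation gives \<open>b = w a w\<inverse>\<close>.\<close>

lemma meridian_gen_class: "gen_class p q g \<in> meridians p q"
proof -
  let ?G = "knot_group p q" and ?R = "{two_bridge_relator p q}"
  interpret group ?G by (rule group_knot_group)
  let ?a = "gen_class p q GenA" and ?b = "gen_class p q GenB"
  define w where "w = pres_class ?R (two_bridge_word p q)"
  have w: "w \<in> carrier ?G" by (simp add: w_def knot_group_def)
  have "pres_class ?R (two_bridge_word p q @ [(GenA, True)])
      = pres_class ?R ([(GenB, True)] @ two_bridge_word p q)"
    by (rule pres_class_relation) (simp add: two_bridge_relator_def)
  then have "w \<otimes>\<^bsub>?G\<^esub> ?a = ?b \<otimes>\<^bsub>?G\<^esub> w"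
    unfolding w_def gen_class_def knot_group_def pres_class_mult .
  then have "?b = w \<otimes>\<^bsub>?G\<^esub> ?a \<otimes>\<^bsub>?G\<^esub> inv\<^bsub>?G\<^esub> w"
    using w by (simp add: inv_solve_right)
  moreover have "?a = \<one>\<^bsub>?G\<^esub> \<otimes>\<^bsub>?G\<^esub> ?a \<otimes>\<^bsub>?G\<^esub> inv\<^bsub>?G\<^esub> \<one>\<^bsub>?G\<^esub>"
    by simp
  ultimately show ?thesis
    using w one_closed unfolding meridians_def Let_def by (cases g) blast+
qed

text \<open>The trace is invariant under conjugation, and the inverse of a trace-zero element of
  SU(2) has trace zero.\<close>

lemma traceless_rep_iff:
  assumes "\<rho> \<in> hom (knot_group p q) SU2"
  shows "traceless_rep p q \<rho> \<longleftrightarrow> trace (\<rho> (gen_class p q GenA)) = 0"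
proof
  assume "traceless_rep p q \<rho>"
  then show "trace (\<rho> (gen_class p q GenA)) = 0"
    using meridian_gen_class by (auto simp: traceless_rep_def)
next
  assume 0: "trace (\<rho> (gen_class p q GenA)) = 0"
  interpret group_hom "knot_group p q" SU2 \<rho>
    using assms by (simp add: group_hom_def group_hom_axioms_def group_knot_group group_SU2)
  let ?a = "gen_class p q GenA"
  have "trace (\<rho> m) = 0" if "m \<in> meridians p q" for m
  proof -
    let ?G = "knot_group p q"
    have "\<exists>g\<in>carrier ?G. m \<in> {g \<otimes>\<^bsub>?G\<^esub> ?a \<otimes>\<^bsub>?G\<^esub> inv\<^bsub>?G\<^esub> g, g \<otimes>\<^bsub>?G\<^esub> inv\<^bsub>?G\<^esub> ?a \<otimes>\<^bsub>?G\<^esub> inv\<^bsub>?G\<^esub> g}"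
      using that unfolding meridians_def Let_def UN_iff .
    then obtain g where g: "g \<in> carrier ?G"
      and m: "m \<in> {g \<otimes>\<^bsub>?G\<^esub> ?a \<otimes>\<^bsub>?G\<^esub> inv\<^bsub>?G\<^esub> g, g \<otimes>\<^bsub>?G\<^esub> inv\<^bsub>?G\<^esub> ?a \<otimes>\<^bsub>?G\<^esub> inv\<^bsub>?G\<^esub> g}"
      by (rule bexE)
    have conj: "trace (\<rho> (g \<otimes>\<^bsub>?G\<^esub> c \<otimes>\<^bsub>?G\<^esub> inv\<^bsub>?G\<^esub> g)) = 0"
      if "c \<in> carrier ?G" "trace (\<rho> c) = 0" for c
      using that g trace_SU2_conj[OF hom_closed[OF g], of "\<rho> c"] by simp
    have "trace (\<rho> (inv\<^bsub>?G\<^esub> ?a)) = 0"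
      using 0 by (simp add: trace_inv_SU2)
    then show ?thesis
      using m conj[of ?a] conj[of "inv\<^bsub>?G\<^esub> ?a"] 0 by (elim insertE emptyE) simp_all
  qed
  then show "traceless_rep p q \<rho>" using assms by (simp add: traceless_rep_def)
qed

lemma traceless_repD:
  assumes "traceless_rep p q \<rho>"
  shows "\<rho> \<in> hom (knot_group p q) SU2" "\<rho> (gen_class p q g) \<in> carrier SU2"
    "trace (\<rho> (gen_class p q g)) = 0"
  using assms meridian_gen_class[of p q g] by (auto simp: traceless_rep_def hom_def)

lemma cos_meridian_angle:
  assumes "traceless_rep p q \<rho>"
  shows "cos (meridian_angle p q \<rho>)
    = imag_part (\<rho> (gen_class p q GenA)) \<bullet> imag_part (\<rho> (gen_class p q GenB))"
  using imag_part_inner_bound[OF traceless_repD(2,3)[OF assms] traceless_repD(2,3)[OF assms]]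
  by (simp add: meridian_angle_def cos_arccos_abs)

lemma meridian_angle_bounds:
  assumes "traceless_rep p q \<rho>"
  shows "0 \<le> meridian_angle p q \<rho>" "meridian_angle p q \<rho> \<le> pi"
  using imag_part_inner_bound[OF traceless_repD(2,3)[OF assms, of GenA]
      traceless_repD(2,3)[OF assms, of GenB]]
  by (auto simp: meridian_angle_def intro: arccos_lbound arccos_ubound)

lemma traceless_rep_normal_form:
  assumes "traceless_rep p q \<rho>"
  obtains g where "g \<in> carrier SU2"
    "\<And>w. g ** \<rho> (pres_class {two_bridge_relator p q} w) ** inv\<^bsub>SU2\<^esub> g
      = word_eval SU2 (std_pair (meridian_angle p q \<rho>)) w"
proof -
  note \<rho> = traceless_repD[OF assms]
  obtain g where g: "g \<in> carrier SU2"
    "g ** \<rho> (gen_class p q GenA) ** inv\<^bsub>SU2\<^esub> g = std_pair (meridian_angle p q \<rho>) GenA"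
    "g ** \<rho> (gen_class p q GenB) ** inv\<^bsub>SU2\<^esub> g = std_pair (meridian_angle p q \<rho>) GenB"
    using traceless_pair_normal_form[OF \<rho>(2,3) \<rho>(2,3)] unfolding meridian_angle_def by blast
  then have gen: "(\<lambda>x. g ** \<rho> (gen_class p q x) ** inv\<^bsub>SU2\<^esub> g) = std_pair (meridian_angle p q \<rho>)"
    by (intro ext, case_tac x) simp_all
  have "(\<lambda>x. g ** \<rho> x ** inv\<^bsub>SU2\<^esub> g) \<in> hom (knot_group p q) SU2"
    using hom_conjugate[OF group_SU2 \<rho>(1) g(1)] by simp
  from hom_knot_group_word[OF this] gen g(1) show thesis
    by (intro that) simp_all
qed

text \<open>The relator is trivial in the knot group, so the standard pair conjugate to
  \<open>\<rho>\<close> satisfies it and \<open>std_pair_relator\<close> applies.\<close>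

lemma traceless_rep_angle:
  assumes "traceless_rep p q \<rho>" "odd p"
  shows "cos (real p * meridian_angle p q \<rho>) = 1"
proof -
  let ?R = "{two_bridge_relator p q}"
  interpret group_hom "knot_group p q" SU2 \<rho>
    using traceless_repD(1)[OF assms(1)]
    by (simp add: group_hom_def group_hom_axioms_def group_knot_group group_SU2)
  obtain g where g: "g \<in> carrier SU2"
    "\<And>w. g ** \<rho> (pres_class ?R w) ** inv\<^bsub>SU2\<^esub> g
      = word_eval SU2 (std_pair (meridian_angle p q \<rho>)) w"
    using traceless_rep_normal_form[OF assms(1)] by blast
  have "pres_class ?R (two_bridge_relator p q) = pres_class ?R []"
    using pres_eq.relator[of "two_bridge_relator p q" ?R "[]" "[]"]
    by (simp add: pres_class_eq_iff)
  then have "\<rho> (pres_class ?R (two_bridge_relator p q)) = mat 1"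
    using hom_one by (simp add: knot_group_def one_presented_group)
  then have "word_eval SU2 (std_pair (meridian_angle p q \<rho>)) (two_bridge_relator p q) = mat 1"
    using group.r_inv[OF group_SU2 g(1)] by (simp flip: g(2))
  then show ?thesis by (simp add: std_pair_relator[OF assms(2)])
qed

section \<open>Conjugacy classes and the meridian angle\<close>

text \<open>The cosine is read off from the trace of the product of the two generators, a
  conjugation invariant. Conversely, equal angles give the same normal form.\<close>

lemma conj_reps_iff:
  assumes "traceless_rep p q \<rho>" "traceless_rep p q \<sigma>"
  shows "(\<rho>, \<sigma>) \<in> conj_reps (knot_group p q) \<longleftrightarrow>
    cos (meridian_angle p q \<rho>) = cos (meridian_angle p q \<sigma>)"
proof -
  interpret SU2: group SU2 by (rule group_SU2)
  note \<rho> = traceless_repD[OF assms(1)] and \<sigma> = traceless_repD[OF assms(2)]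
  let ?a = "gen_class p q GenA" and ?b = "gen_class p q GenB"
  have "cos (meridian_angle p q \<rho>) = cos (meridian_angle p q \<sigma>)"
    if "(\<rho>, \<sigma>) \<in> conj_reps (knot_group p q)"
  proof -
    from that obtain g where g: "g \<in> carrier SU2"
      "\<And>x. x \<in> carrier (knot_group p q) \<Longrightarrow> \<sigma> x = g ** \<rho> x ** inv\<^bsub>SU2\<^esub> g"
      by (auto simp: conj_reps_def)
    have "inv\<^bsub>SU2\<^esub> g ** g = mat 1" using SU2.l_inv[OF g(1)] by simp
    moreover have "\<sigma> ?a ** \<sigma> ?b = g ** \<rho> ?a ** (inv\<^bsub>SU2\<^esub> g ** g) ** \<rho> ?b ** inv\<^bsub>SU2\<^esub> g"
      by (simp add: g(2) matrix_mul_assoc)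
    ultimately have "\<sigma> ?a ** \<sigma> ?b = g ** (\<rho> ?a ** \<rho> ?b) ** inv\<^bsub>SU2\<^esub> g"
      by (simp add: matrix_mul_assoc)
    then have "trace (\<sigma> ?a ** \<sigma> ?b) = trace (\<rho> ?a ** \<rho> ?b)"
      by (simp only: trace_SU2_conj[OF g(1)])
    then show ?thesis
      unfolding cos_meridian_angle[OF assms(1)] cos_meridian_angle[OF assms(2)]
        imag_part_inner[OF \<rho>(2,3) \<rho>(2,3)] imag_part_inner[OF \<sigma>(2,3) \<sigma>(2,3)]
      by (simp only:)
  qed
  moreover have "(\<rho>, \<sigma>) \<in> conj_reps (knot_group p q)"
    if "cos (meridian_angle p q \<rho>) = cos (meridian_angle p q \<sigma>)"
  proof -
    have eq: "meridian_angle p q \<rho> = meridian_angle p q \<sigma>"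
      by (rule cos_inj_pi[OF meridian_angle_bounds[OF assms(1)] meridian_angle_bounds[OF assms(2)] that])
    obtain g where g: "g \<in> carrier SU2"
      "\<And>w. g ** \<rho> (pres_class {two_bridge_relator p q} w) ** inv\<^bsub>SU2\<^esub> g
        = word_eval SU2 (std_pair (meridian_angle p q \<rho>)) w"
      using traceless_rep_normal_form[OF assms(1)] by blast
    obtain h where h: "h \<in> carrier SU2"
      "\<And>w. h ** \<sigma> (pres_class {two_bridge_relator p q} w) ** inv\<^bsub>SU2\<^esub> h
        = word_eval SU2 (std_pair (meridian_angle p q \<sigma>)) w"
      using traceless_rep_normal_form[OF assms(2)] by blast
    \<comment> \<open>Go from \<open>\<rho>\<close> to the common normal form by \<open>g\<close>,
      then back to \<open>\<sigma>\<close> by the inverse of \<open>h\<close>.\<close>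
    let ?k = "inv\<^bsub>SU2\<^esub> h ** g"
    have k: "?k \<in> carrier SU2"
      using SU2.m_closed[OF SU2.inv_closed[OF h(1)] g(1)] by simp
    have hh: "inv\<^bsub>SU2\<^esub> h ** h = mat 1" using SU2.l_inv[OF h(1)] by simp
    have "\<sigma> x = ?k ** \<rho> x ** inv\<^bsub>SU2\<^esub> ?k" if x: "x \<in> carrier (knot_group p q)" for x
    proof -
      have \<rho>x: "\<rho> x \<in> carrier SU2"
        using \<rho>(1) x by (auto simp: hom_def)
      define N where "N = h ** \<sigma> x ** inv\<^bsub>SU2\<^esub> h"
      obtain w where "x = pres_class {two_bridge_relator p q} w"
        using x by (auto simp: knot_group_def carrier_presented_group)
      then have "g ** \<rho> x ** inv\<^bsub>SU2\<^esub> g = N" by (simp add: g(2) h(2) eq N_def)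
      then have gr: "g ** \<rho> x = N ** g" using SU2_conj_iff[OF g(1) \<rho>x] by blast
      have hN: "inv\<^bsub>SU2\<^esub> h ** N = \<sigma> x ** inv\<^bsub>SU2\<^esub> h"
        unfolding N_def by (simp add: hh matrix_mul_assoc)
      have "?k ** \<rho> x = inv\<^bsub>SU2\<^esub> h ** (g ** \<rho> x)" by (simp only: matrix_mul_assoc)
      also have "\<dots> = inv\<^bsub>SU2\<^esub> h ** N ** g" by (simp only: gr matrix_mul_assoc)
      also have "\<dots> = \<sigma> x ** ?k" by (simp only: hN matrix_mul_assoc)
      finally show ?thesis by (rule HOL.sym[OF SU2_conj_iff[OF k \<rho>x, THEN iffD2]])
    qed
    then show ?thesis
      using k unfolding conj_reps_def mult_SU2 by blast
  qed
  ultimately show ?thesis by blast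
qed

section \<open>Binary-dihedral image\<close>

lemma Pin2_eq: "Pin2 = range (\<lambda>t. quat (cos t) (sin t) 0 0) \<union> range (\<lambda>t. quat 0 0 (cos t) (- sin t))"
  by (auto simp: Pin2_def quat_mult)

text \<open>Every letter evaluates to some \<open>j exp(i s)\<close>, and left multiplication by
  such an element exchanges the two components of Pin(2).\<close>

lemma Pin2_word_eval_std_pair: "word_eval SU2 (std_pair \<phi>) w \<in> Pin2"
proof (induction w)
  case Nil
  show ?case
    unfolding Pin2_eq by (intro UnI1 image_eqI[of _ _ 0]) (simp_all add: mat_1_eq_quat)
next
  case (Cons l w)
  have rot: "quat 0 0 (cos s) (- sin s) ** M \<in> Pin2" if "M \<in> Pin2" for s M
  proof -
    from that obtain t where "M = quat (cos t) (sin t) 0 0 \<or> M = quat 0 0 (cos t) (- sin t)"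
      by (auto simp: Pin2_eq)
    \<comment> \<open>On the second component
      \<open>j exp(i s) j exp(i t) = - exp(i (t - s))\<close>; the shift by \<open>pi\<close>
      absorbs the sign.\<close>
    then have "quat 0 0 (cos s) (- sin s) ** M \<in>
        {quat 0 0 (cos (s + t)) (- sin (s + t)), quat (cos (t - s + pi)) (sin (t - s + pi)) 0 0}"
      by (auto simp: quat_mult quat_eq_iff cos_add sin_add cos_diff sin_diff)
    then show ?thesis unfolding Pin2_eq by blast
  qed
  obtain g e where l: "l = (g, e)" by (cases l)
  \<comment> \<open>Inverting an imaginary unit negates it, which adds \<open>pi\<close> to its
    angle.\<close>
  define s where "s = (case g of GenA \<Rightarrow> 0 | GenB \<Rightarrow> \<phi>) + (if e then 0 else pi)"
  have "(if e then std_pair \<phi> g else inv\<^bsub>SU2\<^esub> std_pair \<phi> g) = quat 0 0 (cos s) (- sin s)"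
    by (cases g; cases e) (simp_all add: s_def inv_quat quat_eq_iff)
  then show ?case using rot[OF Cons] by (simp add: l)
qed

lemma traceless_rep_binary_dihedral:
  assumes "traceless_rep p q \<rho>"
  shows "binary_dihedral (knot_group p q) \<rho>"
proof -
  obtain g where g: "g \<in> carrier SU2"
    "\<And>w. g ** \<rho> (pres_class {two_bridge_relator p q} w) ** inv\<^bsub>SU2\<^esub> g
      = word_eval SU2 (std_pair (meridian_angle p q \<rho>)) w"
    using traceless_rep_normal_form[OF assms] by blast
  then show ?thesis
    unfolding binary_dihedral_def
    by (intro bexI[of _ g])
       (auto simp: knot_group_def carrier_presented_group Pin2_word_eval_std_pair)
qed

section \<open>Irreducibility and the admissible angles\<close>

text \<open>At angle 0 both generators have the same image \<open>A\<close>, so the whole image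
  commutes with \<open>A\<close> and preserves its \<open>\<i>\<close>-eigenspace. That space is
  proper and nonzero because \<open>A\<close> has trace zero and square \<open>-1\<close>.\<close>

lemma irreducible_angle_nonzero:
  assumes "traceless_rep p q \<rho>" "irreducible_rep (knot_group p q) \<rho>"
  shows "meridian_angle p q \<rho> \<noteq> 0"
proof
  assume 0: "meridian_angle p q \<rho> = 0"
  note \<rho> = traceless_repD[OF assms(1)]
  interpret SU2: group SU2 by (rule group_SU2)
  define A where "A = \<rho> (gen_class p q GenA)"
  obtain g where g: "g \<in> carrier SU2"
    "\<And>w. g ** \<rho> (pres_class {two_bridge_relator p q} w) ** inv\<^bsub>SU2\<^esub> g
      = word_eval SU2 (std_pair (meridian_angle p q \<rho>)) w"
    using traceless_rep_normal_form[OF assms(1)] by blast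
  have A: "A \<in> carrier SU2" "trace A = 0" using \<rho> by (simp_all add: A_def)
  have "g ** \<rho> (gen_class p q x) ** inv\<^bsub>SU2\<^esub> g = std_pair 0 GenA" for x
    unfolding gen_class_def g(2) 0 by (cases x) simp_all
  then have "g ** \<rho> (gen_class p q x) = g ** A" for x
    using SU2_conj_iff[OF g(1) \<rho>(2)] by (metis A_def)
  then have gen: "\<rho> (gen_class p q x) = A" for x
    using SU2.Units_l_cancel[of g "\<rho> (gen_class p q x)" A for x] g(1) \<rho>(2) A(1)
    by (simp add: SU2.Units_eq)
  have invA: "inv\<^bsub>SU2\<^esub> A = - A" and AA: "A ** A = - mat 1"
    by (rule traceless_SU2E[OF A];
        simp add: inv_quat minus_quat mat_1_eq_quat quat_mult quat_eq_iff power2_eq_square)+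
  have comm: "word_eval SU2 (\<lambda>g. A) w ** A = A ** word_eval SU2 (\<lambda>g :: generator. A) w" for w
  proof (induction w)
    case (Cons l w)
    obtain g e where l: "l = (g, e)" by (cases l)
    show ?case
      using Cons by (simp add: l invA matrix_mult_minus flip: matrix_mul_assoc)
  qed simp
  have mat_vec: "mat c *v v = c *s v" for c and v :: "complex^2"
    by (simp add: vec_eq_iff forall_2 matrix_vector_mult_def sum_2 mat_def)
  let ?V = "{v. A *v v = \<i> *s v}"
  have inv: "\<rho> x *v v \<in> ?V" if x: "x \<in> carrier (knot_group p q)" and v: "v \<in> ?V" for x v
  proof -
    obtain w where "x = pres_class {two_bridge_relator p q} w"
      using x by (auto simp: knot_group_def carrier_presented_group)
    then have "A ** \<rho> x = \<rho> x ** A"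
      using hom_knot_group_word[OF \<rho>(1), of w] comm[of w] by (simp add: gen)
    then have "A *v (\<rho> x *v v) = \<rho> x *v (A *v v)"
      by (simp add: matrix_vector_mul_assoc)
    then show ?thesis using v by (simp add: vec.scale)
  qed
  have "vec.subspace ?V"
    by (auto simp: vec.subspace_def vec.add vec.scale vec.scale_right_distrib mult.commute)
  with inv assms(2) consider "?V = {0}" | "?V = UNIV"
    unfolding irreducible_rep_def by meson
  then show False
  proof cases
    case 1
    \<comment> \<open>Since \<open>A\<^sup>2 = - 1\<close>, the operator \<open>A + \<i>\<close>
      maps into the \<open>\<i>\<close>-eigenspace; if that is zero, \<open>A\<close> is the scalar
      \<open>- \<i>\<close>.\<close>
    have "A *v v + \<i> *s v \<in> ?V" for v
    proof -
      have "- mat 1 *v v = - v"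
        by (simp add: vec_eq_iff forall_2 matrix_vector_mult_def sum_2 mat_def)
      then show ?thesis
        using AA by (simp add: vec.add vec.scale matrix_vector_mul_assoc)
    qed
    then have "A *v v + \<i> *s v = 0" for v using 1 by blast
    then have "A *v v = mat (- \<i>) *v v" for v
      unfolding mat_vec by (simp only: vec.scale_minus_left eq_neg_iff_add_eq_0)
    then have "A = mat (- \<i>)" unfolding matrix_eq by (rule allI)
    then have "trace A = - 2 * \<i>" by (simp only: trace_def sum_2 mat_def) simp
    then show False using A(2) by simp
  next
    case 2
    have "A *v v = mat \<i> *v v" for v
    proof -
      have "v \<in> ?V" unfolding 2 by (rule UNIV_I)
      then show ?thesis unfolding mat_vec by simp
    qed
    then have "A = mat \<i>" unfolding matrix_eq by (rule allI)
    then have "trace A = 2 * \<i>" by (simp only: trace_def sum_2 mat_def) simp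
    then show False using A(2) by simp
  qed
qed

text \<open>The angle is \<open>2 pi m / p\<close> for an integer \<open>m\<close>; lying in
  \<open>(0, pi]\<close> it forces \<open>0 < 2 m \<le> p\<close>, and oddness of \<open>p\<close>
  improves this to \<open>m \<le> (p - 1) / 2\<close>.\<close>

lemma irreducible_angle:
  assumes "\<rho> \<in> irred_traceless_reps p q" "odd p"
  shows "\<exists>k\<in>{1..(p - 1) div 2}. meridian_angle p q \<rho> = 2 * pi * real k / real p"
proof -
  have \<rho>: "traceless_rep p q \<rho>" "irreducible_rep (knot_group p q) \<rho>"
    using assms(1) by (auto simp: irred_traceless_reps_def)
  let ?\<phi> = "meridian_angle p q \<rho>"
  have p: "p > 0" using assms(2) by (cases p) auto
  have pos: "?\<phi> > 0" and le: "?\<phi> \<le> pi"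
    using meridian_angle_bounds[OF \<rho>(1)] irreducible_angle_nonzero[OF \<rho>] by auto
  obtain m :: int where m: "real p * ?\<phi> = m * 2 * pi"
    using traceless_rep_angle[OF \<rho>(1) assms(2)] by (auto simp: cos_one_2pi_int)
  have "0 < real p * ?\<phi>" "real p * ?\<phi> \<le> real p * pi"
    using pos le p by auto
  then have "0 < real_of_int m * 2" "real_of_int m * 2 \<le> real p"
    unfolding m by (simp_all add: zero_less_mult_iff)
  then have "0 < m" "2 * m \<le> int p" by linarith+
  moreover have "?\<phi> = 2 * pi * real (nat m) / real p"
    using m p \<open>0 < m\<close> by (simp add: field_simps)
  ultimately show ?thesis
    using assms(2) by (intro bexI[of _ "nat m"]) (auto elim!: oddE)
qed

text \<open>The standard pair at this angle satisfies the relator and so lifts to the knot group. It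
  is irreducible because the angle lies strictly between 0 and \<open>pi\<close>.\<close>

lemma std_rep_exists:
  assumes "odd p" "k \<in> {1..(p - 1) div 2}"
  shows "\<exists>\<rho>\<in>irred_traceless_reps p q. meridian_angle p q \<rho> = 2 * pi * real k / real p"
proof -
  define \<phi> where "\<phi> = 2 * pi * real k / real p"
  have p: "p > 0" and k: "k > 0" "2 * k < p" using assms by auto
  have "0 < \<phi>" using p k by (simp add: \<phi>_def)
  have "\<phi> = pi * (real (2 * k) / real p)" by (simp add: \<phi>_def)
  also have "\<dots> < pi * 1"
    by (intro mult_strict_left_mono) (use p k in \<open>simp_all add: divide_less_eq_1 del: of_nat_mult\<close>)
  finally have "\<phi> < pi" by simp
  have "real p * \<phi> = real k * 2 * pi" using p by (simp add: \<phi>_def)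
  then have "cos (real p * \<phi>) = 1" using cos_one_2pi by blast
  then have rel: "word_eval SU2 (std_pair \<phi>) (two_bridge_relator p q) = \<one>\<^bsub>SU2\<^esub>"
    using std_pair_relator[OF assms(1)] by simp
  obtain \<rho> where \<rho>: "\<rho> \<in> hom (knot_group p q) SU2"
    "\<And>w. \<rho> (pres_class {two_bridge_relator p q} w) = word_eval SU2 (std_pair \<phi>) w"
    using presented_group_lift[OF group_SU2 std_pair_in_SU2, of "{two_bridge_relator p q}" \<phi>] rel
    unfolding knot_group_def by blast
  have gen: "\<rho> (gen_class p q g) = std_pair \<phi> g" for g
    by (simp add: gen_class_def \<rho>(2))
  have traceless: "traceless_rep p q \<rho>"
    by (simp add: traceless_rep_iff[OF \<rho>(1)] gen trace_quat)
  have "meridian_angle p q \<rho> = \<phi>"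
    using \<open>0 < \<phi>\<close> \<open>\<phi> < pi\<close>
    by (simp add: meridian_angle_def gen imag_part_quat inner_vec_def sum_3 arccos_cos)
  moreover have "irreducible_rep (knot_group p q) \<rho>"
    unfolding irreducible_rep_def
  proof (intro allI impI)
    fix V assume V: "vec.subspace V \<and> (\<forall>x\<in>carrier (knot_group p q). \<forall>v\<in>V. \<rho> x *v v \<in> V)"
    have sub: "x + y \<in> V" "c *s x \<in> V" if "x \<in> V" "y \<in> V" for x y c
      using V that by (auto simp: vec.subspace_def)
    have J: "vector [v $ 2, - (v $ 1)] \<in> V"
      and B: "vector [cnj (cis \<phi>) * v $ 2, - (cis \<phi> * v $ 1)] \<in> V" if "v \<in> V" for v
    proof -
      have "std_pair \<phi> g *v v \<in> V" for g
        using V that gen by (metis gen_class_in_carrier)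
      moreover have "std_pair \<phi> GenA *v v = vector [v $ 2, - (v $ 1)]"
        "std_pair \<phi> GenB *v v = vector [cnj (cis \<phi>) * v $ 2, - (cis \<phi> * v $ 1)]"
        by (auto simp: quat_def vec_eq_iff forall_2 matrix_vector_mult_def sum_2 complex_eq_iff)
      ultimately show "vector [v $ 2, - (v $ 1)] \<in> V"
        "vector [cnj (cis \<phi>) * v $ 2, - (cis \<phi> * v $ 1)] \<in> V" by metis+
    qed
    have "V = UNIV" if ne: "V \<noteq> {0}"
    proof -
      have "0 \<in> V" using V by (auto simp: vec.subspace_def)
      with ne obtain v where v: "v \<in> V" "v \<noteq> 0" by auto
      have e2: "vector [0, 1] \<in> V"
      proof (cases "v $ 1 = 0")
        case True
        with v(2) have "v $ 2 \<noteq> 0" by (auto simp: vec_eq_iff forall_2)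
        with True have "vector [0, 1] = inverse (v $ 2) *s v"
          by (simp add: vec_eq_iff forall_2)
        then show ?thesis using sub(2)[OF v(1) v(1)] by simp
      next
        case False
        let ?c = "(cnj (cis \<phi>) - cis \<phi>) * v $ 1"
        have "sin \<phi> \<noteq> 0" using sin_gt_zero[OF \<open>0 < \<phi>\<close> \<open>\<phi> < pi\<close>] by simp
        then have c: "?c \<noteq> 0" using False by (auto simp: complex_eq_iff)
        \<comment> \<open>This combination of the two generator images of \<open>v\<close> cancels
          the first coordinate; what remains is nonzero since
          \<open>sin \<phi> \<noteq> 0\<close>.\<close>
        have "vector [cnj (cis \<phi>) * v $ 2, - (cis \<phi> * v $ 1)]
            + (- cnj (cis \<phi>)) *s vector [v $ 2, - (v $ 1)] = (vector [0, ?c] :: complex^2)"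
          by (simp add: vec_eq_iff forall_2 algebra_simps)
        then have "vector [0, ?c] \<in> V"
          using sub J[OF v(1)] B[OF v(1)] by metis
        moreover have "vector [0, 1] = inverse ?c *s (vector [0, ?c] :: complex^2)"
          using left_inverse[OF c] by (simp only: vec_eq_iff forall_2 vector_smult_component vector_2 mult_zero_right)
        ultimately show ?thesis
          using sub(2) by metis
      qed
      have e1: "vector [1, 0] \<in> V" using J[OF e2] by simp
      have "x \<in> V" for x
      proof -
        have "x = x $ 1 *s vector [1, 0] + x $ 2 *s vector [0, 1]"
          by (simp add: vec_eq_iff forall_2)
        then show ?thesis using sub e1 e2 by metis
      qed
      then show ?thesis by auto
    qed
    then show "V = {0} \<or> V = UNIV" by blast
  qed
  ultimately show ?thesis
    using traceless by (auto simp: irred_traceless_reps_def \<phi>_def)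
qed

section \<open>The traceless Riley polynomial\<close>

text \<open>Chebyshev polynomials of the fourth kind evaluated at \<open>1 + u / 2\<close>; the
  index \<open>n\<close> belongs to \<open>p = 2 n + 1\<close>.\<close>

fun traceless_poly :: "nat \<Rightarrow> complex poly" where
  "traceless_poly 0 = 1"
| "traceless_poly (Suc 0) = [:3, 1:]"
| "traceless_poly (Suc (Suc n)) = [:2, 1:] * traceless_poly (Suc n) - traceless_poly n"

lemma traceless_poly_degree_lead_coeff:
  "degree (traceless_poly n) = n \<and> coeff (traceless_poly n) n = 1"
proof (induction n rule: traceless_poly.induct)
  case (3 n)
  have d: "degree (traceless_poly (Suc (Suc n))) \<le> Suc (Suc n)"
    using 3 degree_mult_le[of "[:2, 1:]" "traceless_poly (Suc n)"]
    by (auto intro!: degree_diff_le)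
  have "coeff (traceless_poly (Suc (Suc n))) (Suc (Suc n)) = 1"
    using 3 by (simp add: coeff_eq_0)
  then show ?case using d le_antisym[OF d le_degree] by auto
qed auto

lemma degree_traceless_poly [simp]: "degree (traceless_poly n) = n"
  and coeff_traceless_poly_top [simp]: "coeff (traceless_poly n) n = 1"
  using traceless_poly_degree_lead_coeff by auto

lemma coeff_traceless_poly_Ints: "coeff (traceless_poly n) i \<in> \<int>"
proof (induction n arbitrary: i rule: traceless_poly.induct)
  case (3 n)
  then show ?case by (cases i) auto
qed (auto simp: coeff_pCons split: nat.split)

text \<open>At \<open>u = 0\<close> the recurrence is that of an arithmetic progression, starting
  with 1 and 3.\<close>

lemma traceless_poly_at_0: "poly (traceless_poly n) 0 = of_nat (2 * n + 1)"
  by (induction n rule: traceless_poly.induct) auto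

text \<open>The factor \<open>u + 2\<close> adds twice the leading coefficient 1 at each step, while
  the subtracted polynomial has too small a degree to contribute.\<close>

lemma coeff_traceless_poly_subtop: "coeff (traceless_poly (Suc n)) n = of_nat (2 * n + 3)"
proof (induction n rule: induct_nat_012)
  case (ge2 n)
  then show ?case by (simp add: coeff_eq_0 del: traceless_poly.simps(3) add: traceless_poly.simps(3)[of "Suc n"])
qed (auto simp: coeff_eq_0 numeral_2_eq_2)

text \<open>By the addition formulas, sines of odd multiples of \<open>x\<close> obey the same
  recurrence with \<open>u + 2 = 2 cos 2x\<close>. Keeping \<open>sin x\<close> as a factor avoids a
  division.\<close>

lemma traceless_poly_sin:
  "poly (traceless_poly n) (of_real (2 * cos (2 * x) - 2)) * of_real (sin x)
     = complex_of_real (sin (real (2 * n + 1) * x))"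
proof (induction n rule: traceless_poly.induct)
  case 2
  have "sin (3 * x) = (2 * cos (2 * x) + 1) * sin x"
    using sin_add[of x "2 * x"] sin_diff[of x "2 * x"] by (simp add: algebra_simps)
  then show ?case by simp
next
  case (3 n)
  have "sin (real (2 * Suc (Suc n) + 1) * x) =
     2 * cos (2 * x) * sin (real (2 * Suc n + 1) * x) - sin (real (2 * n + 1) * x)"
    using sin_add[of "real (2 * Suc n + 1) * x" "2 * x"] sin_diff[of "real (2 * Suc n + 1) * x" "2 * x"]
    by (simp add: algebra_simps)
  moreover have "poly (traceless_poly (Suc (Suc n))) z * s
      = (2 + z) * (poly (traceless_poly (Suc n)) z * s) - poly (traceless_poly n) z * s" for z s
    by (simp add: algebra_simps)
  ultimately show ?case
    by (simp only: 3) (simp del: of_nat_Suc of_nat_add mult_Suc_right)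
qed simp

section \<open>Monic polynomials as products of linear factors\<close>

text \<open>Two monic polynomials of the same degree coincide once they agree at that many distinct
  points.\<close>

lemma prod_linear_root_poly:
  fixes P :: "'a::idom poly"
  assumes "finite I" "inj_on r I" "\<And>i. i \<in> I \<Longrightarrow> poly P (- r i) = 0"
    "degree P = card I" "lead_coeff P = 1"
  shows "P = (\<Prod>i\<in>I. [:r i, 1:])"
proof (rule poly_eqI_degree_lead_coeff[where A = "(\<lambda>i. - r i) ` I"])
  have "lead_coeff (\<Prod>i\<in>I. [:r i, 1:]) = 1"
    by (simp add: lead_coeff_prod)
  moreover have d: "degree (\<Prod>i\<in>I. [:r i, 1:]) = card I"
    by (simp add: degree_prod_eq_sum_degree)
  ultimately show "coeff P (card I) = coeff (\<Prod>i\<in>I. [:r i, 1:]) (card I)"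
    using assms by simp
  show "card ((\<lambda>i. - r i) ` I) \<ge> card I"
    using assms by (simp add: card_image inj_on_def)
qed (use assms in \<open>auto simp: poly_prod degree_prod_eq_sum_degree prod_zero_iff\<close>)

text \<open>Vieta's formula for the root sum; no sign appears because the roots are
  \<open>- r i\<close>. Both coefficients go through one induction, since the second needs the first
  for the shorter product.\<close>

lemma coeff_prod_linear:
  assumes "finite I"
  shows "coeff (\<Prod>i\<in>I. [:r i, 1:]) (card I) = (1 :: 'a::comm_ring_1)"
    "card I = Suc m \<Longrightarrow> coeff (\<Prod>i\<in>I. [:r i, 1:]) m = (\<Sum>i\<in>I. r i)"
  using assms
proof (induction I arbitrary: m rule: finite_induct)
  case (insert x I)
  {
    case 1
    have "degree (\<Prod>i\<in>I. [:r i, 1:]) \<le> card I"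
      by (rule order.trans[OF degree_prod_sum_le]) (use insert in \<open>auto intro: sum_bounded_above[where K = 1, simplified]\<close>)
    then show ?case using insert by (simp add: coeff_eq_0)
  next
    case 2
    then show ?case using insert by (cases m) (auto simp: card_eq_0_iff)
  }
qed auto

section \<open>Riley matrices at trace zero\<close>

lemma matrix_inv_eq_minus:
  fixes A :: "'a::comm_ring_1^'n^'n"
  assumes "A ** A = - mat 1"
  shows "matrix_inv A = - A"
proof -
  have inv: "A ** (- A) = mat 1" "(- A) ** A = mat 1"
    using assms by (simp_all add: matrix_mult_minus)
  have "A ** matrix_inv A = mat 1 \<and> matrix_inv A ** A = mat 1"
    unfolding matrix_inv_def by (rule someI[of _ "- A"]) (use inv in auto)
  then show ?thesis
    using inv by (metis matrix_mul_assoc matrix_mul_lid matrix_mul_rid)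
qed

text \<open>At \<open>s = \<i>\<close> both generators have trace 0 and determinant 1, so this is
  Cayley-Hamilton.\<close>

lemma riley_gen_square: "riley_gen \<i> g ** riley_gen \<i> g = - mat 1"
  by (cases g)
     (auto simp: vec_eq_iff forall_2 matrix_matrix_mult_def sum_2 mat_def one_pCons)

text \<open>The constant \<open>- 2 * \<i>\<close> is \<open>inverse s - s\<close> at
  \<open>s = \<i>\<close>. The factor \<open>(- 1) ^ n\<close> turns the trace
  \<open>- 2 - u\<close> of \<open>R\<close> into the coefficient \<open>u + 2\<close> of the
  recurrence.\<close>

lemma riley_matrix_power:
  defines "R \<equiv> riley_gen \<i> GenA ** riley_gen \<i> GenB"
  defines "P \<equiv> \<lambda>n. ((**) R ^^ n) (mat 1)"
  shows "P n $ 1 $ 1 + [:- 2 * \<i>:] * P n $ 1 $ 2 = (- 1) ^ n * traceless_poly n"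
proof (induction n rule: traceless_poly.induct)
  case 1
  then show ?case by (simp add: P_def mat_def)
next
  case 2
  have "P (Suc 0) = R" by (simp add: P_def)
  then show ?case
    by (simp add: R_def matrix_matrix_mult_def sum_2 one_pCons) (simp add: complex_eq_iff)
next
  case (3 n)
  \<comment> \<open>Cayley-Hamilton for \<open>R\<close>, multiplied on the right by
    \<open>M\<close> and written entrywise.\<close>
  have CH: "R ** (R ** M) = (\<chi> i j. [:- 2, - 1:] * (R ** M) $ i $ j - M $ i $ j)" for M
  proof -
    define U I :: "complex poly" where "U = [:0, 1:]" and "I = [:\<i>:]"
    have I: "I * I = - 1" by (simp add: I_def one_pCons)
    have R: "R $ 1 $ 1 = - 1 - U" "R $ 1 $ 2 = - I" "R $ 2 $ 1 = I * U" "R $ 2 $ 2 = - 1"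
      by (simp_all add: R_def U_def I_def matrix_matrix_mult_def sum_2 one_pCons)
    have "[:- 2, - 1:] = - 2 - U" by (simp add: U_def numeral_poly)
    moreover have "(- 1 - U) * ((- 1 - U) * x + - I * y) + - I * (I * U * x + - 1 * y)
        = (- 2 - U) * ((- 1 - U) * x + - I * y) - x"
      "I * U * ((- 1 - U) * x + - I * y) + - 1 * (I * U * x + - 1 * y)
        = (- 2 - U) * (I * U * x + - 1 * y) - y" for x y
      using I by algebra+
    ultimately show ?thesis
      by (simp only: vec_eq_iff forall_2 matrix_matrix_mult_def sum_2 vec_lambda_beta R) simp
  qed
  have "P (Suc (Suc n)) $ i $ j = [:- 2, - 1:] * P (Suc n) $ i $ j - P n $ i $ j" for i j
    using CH[of "P n"] by (simp add: P_def)
  then have "P (Suc (Suc n)) $ 1 $ 1 + [:- 2 * \<i>:] * P (Suc (Suc n)) $ 1 $ 2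
    = [:- 2, - 1:] * (P (Suc n) $ 1 $ 1 + [:- 2 * \<i>:] * P (Suc n) $ 1 $ 2)
      - (P n $ 1 $ 1 + [:- 2 * \<i>:] * P n $ 1 $ 2)"
    by (simp only:) (simp only: algebra_simps)
  also have "\<dots> = [:- 2, - 1:] * ((- 1) ^ Suc n * traceless_poly (Suc n)) - (- 1) ^ n * traceless_poly n"
    using 3 by (simp only:)
  also have "[:- 2, - 1:] = - [:2, 1 :: complex:]" by simp
  also have "- [:2, 1:] * ((- 1) ^ Suc n * traceless_poly (Suc n)) - (- 1) ^ n * traceless_poly n
      = (- 1) ^ Suc (Suc n) * traceless_poly (Suc (Suc n))"
    by (simp only: traceless_poly.simps power_Suc) algebra
  finally show ?case .
qed

text \<open>Both sign ambiguities, from the word and from \<open>(- 1) ^ n\<close>, disappear on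
  division by the leading coefficient.\<close>

lemma traceless_riley_eq:
  assumes "odd p"
  shows "traceless_riley p q = traceless_poly ((p - 1) div 2)"
proof -
  define n where "n = (p - 1) div 2"
  obtain \<epsilon> where w: "two_bridge_word p q =
      map (\<lambda>i. (if odd i then GenA else GenB, \<epsilon> i)) [1..<2 * n + 1]"
    unfolding n_def using two_bridge_word_odd[OF assms] by blast
  define P where "P = ((**) (riley_gen \<i> GenA ** riley_gen \<i> GenB) ^^ n) (mat 1)"
  have W: "riley_word \<i> (two_bridge_word p q) = P \<or> riley_word \<i> (two_bridge_word p q) = - P"
    unfolding riley_word_def w P_def
    by (rule foldr_alternating) (rule matrix_inv_eq_minus[OF riley_gen_square])
  have "riley_poly p q \<i> = traceless_poly n \<or> riley_poly p q \<i> = - traceless_poly n"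
  proof -
    define Q where "Q = P $ 1 $ 1 + [:- 2 * \<i>:] * P $ 1 $ 2"
    have "Q = traceless_poly n \<or> Q = - traceless_poly n"
      using riley_matrix_power[of n, folded P_def]
      by (cases "even n") (auto simp: Q_def)
    moreover have "riley_poly p q \<i> = Q \<or> riley_poly p q \<i> = - Q"
      using W by (auto simp: riley_poly_def Let_def Q_def)
    ultimately show ?thesis by auto
  qed
  then show ?thesis
    unfolding n_def[symmetric] by (auto simp: traceless_riley_def)
qed

section \<open>The determinant and the classification\<close>

text \<open>At \<open>t = - 1\<close> a generator and its inverse both contribute 1 to the
  derivative and both multiply the rest by \<open>- 1\<close>, so a letter counts only through its
  position.\<close>

lemma fox_minus_one:
  "fox g (- 1 :: 'k::field) w = (\<Sum>i<length w. if fst (w ! i) = g then (- 1) ^ i else 0)"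
proof (induction w)
  case (Cons l w)
  obtain h e where l: "l = (h, e)" by (cases l)
  have "inverse (- 1 :: 'k) = - 1" by (simp add: inverse_minus_eq)
  then have "fox g (- 1) (l # w) = (if h = g then 1 else 0) - fox g (- 1 :: 'k) w"
    by (simp add: l)
  also have "\<dots> = (\<Sum>i<length (l # w). if fst ((l # w) ! i) = g then (- 1) ^ i else 0)"
    unfolding list.size Cons
    by (simp add: sum.lessThan_Suc_shift l if_distrib flip: sum_negf del: sum.lessThan_Suc cong: if_cong)
  finally show ?case .
qed simp

text \<open>Inverting the second half of the relator preserves the alternation, since \<open>p\<close> is odd.\<close>

lemma two_bridge_relator_letters:
  assumes "odd p"
  shows "map fst (two_bridge_relator p q) = map (\<lambda>i. if even i then GenA else GenB) [0..<2 * p]"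
proof -
  have fst_inv: "map fst (word_inv w) = rev (map fst w)" for w :: "generator word"
    by (simp add: word_inv_def rev_map split_beta comp_def)
  have p: "p \<ge> 1" using assms by (cases p) auto
  let ?w = "map (\<lambda>i. if odd i then GenA else GenB) [1..<p]"
  have "map fst (two_bridge_relator p q) = (?w @ [GenA]) @ rev (GenB # ?w)"
    by (simp add: two_bridge_relator_def fst_inv two_bridge_word_def comp_def)
  also have "?w @ [GenA] = map (\<lambda>i. if even i then GenA else GenB) [0..<p]"
    using p assms by (intro nth_equalityI) (auto simp: nth_append, presburger)
  also have "GenB # ?w = map (\<lambda>i. if odd i then GenA else GenB) [0..<p]"
    using p by (simp add: upt_conv_Cons)
  also have "rev (map (\<lambda>i. if odd i then GenA else GenB) [0..<p])
      = map (\<lambda>i. if even i then GenA else GenB) [p..<2 * p]"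
    using p assms by (intro nth_equalityI) (auto simp: rev_nth)
  finally show ?thesis
    using upt_add_eq_append[of 0 p p] by (simp add: mult_2)
qed

text \<open>The \<open>p\<close> occurrences of \<open>a\<close> in the relator all sit at even
  positions, so their contributions add up without cancellation.\<close>

lemma knot_det_odd:
  assumes "odd p"
  shows "knot_det p q = real p"
proof -
  note letters = two_bridge_relator_letters[OF assms, of q]
  have len: "length (two_bridge_relator p q) = 2 * p"
    using arg_cong[OF letters, of length] by simp
  have "alexander p q (- 1) = (\<Sum>i<2 * p. if even i then 1 else 0)"
    unfolding alexander_def fox_minus_one len
  proof (rule sum.cong)
    fix i assume "i \<in> {..<2 * p}"
    then have "fst (two_bridge_relator p q ! i) = (if even i then GenA else GenB)"
      using arg_cong[OF letters, of "\<lambda>l. l ! i"] by (simp add: len)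
    then show "(if fst (two_bridge_relator p q ! i) = GenA then (- 1) ^ i else 0)
        = (if even i then 1 else 0 :: real)"
      by simp
  qed simp
  also have "(\<Sum>i<2 * m. if even i then 1 else 0) = real m" for m
    by (induction m) auto
  finally show ?thesis by (simp add: knot_det_def)
qed

lemma sum_mset_sum_singletons: "sum_mset (\<Sum>k\<in>I. {#f k#}) = sum f I"
  by (induction I rule: infinite_finite_induct) simp_all

theorem theorem1p1:
  fixes p :: nat and q :: int
  assumes "p \<ge> 3" and "odd p" and "coprime (int p) q"
  shows "(knot_det p q = real p)
     \<and> (\<forall>\<rho>\<in>irred_traceless_reps p q. binary_dihedral (knot_group p q) \<rho>)
     \<and> (finite (irred_traceless_characters p q)
         \<and> card (irred_traceless_characters p q) = (p - 1) div 2)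
     \<and> (bij_betw
           (\<lambda>k. {\<rho> \<in> irred_traceless_reps p q.
                   cos (meridian_angle p q \<rho>) = cos (2 * pi * real k / real p)})
           {1..(p - 1) div 2} (irred_traceless_characters p q))
     \<and> ({u. poly (traceless_riley p q) u = 0}
         = (\<lambda>\<rho>. complex_of_real (2 * cos (meridian_angle p q \<rho>) - 2)) ` irred_traceless_reps p q)
     \<and> (traceless_riley p q
         = (\<Prod>k = 1..(p - 1) div 2. [:complex_of_real (4 * (sin (pi * real k / real p))\<^sup>2), 1:]))
     \<and> (lead_coeff (traceless_riley p q) = 1)
     \<and> (degree (traceless_riley p q) = (p - 1) div 2)
     \<and> (\<forall>i. coeff (traceless_riley p q) i \<in> \<int>)
     \<and> (poly (traceless_riley p q) 0 = of_nat p)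
     \<and> (poly (traceless_riley p q) 0 = of_real (knot_det p q))
     \<and> (sum_mset (proots (traceless_riley p q)) = - of_nat p)"
proof -
  define n where "n = (p - 1) div 2"
  have p: "p = 2 * n + 1" using assms(2) by (auto simp: n_def elim: oddE)
  have n: "n \<ge> 1" using assms(1) p by simp
  let ?\<theta> = "\<lambda>k. 2 * pi * real k / real p"
  let ?X = "irred_traceless_reps p q"
  let ?angle = "meridian_angle p q"
  let ?F = "\<lambda>k. {\<rho> \<in> ?X. cos (?angle \<rho>) = cos (?\<theta> k)}"
  define r where "r k = complex_of_real (4 * (sin (pi * real k / real p))\<^sup>2)" for k
  have det: "knot_det p q = real p" by (rule knot_det_odd[OF assms(2)])
  have traceless: "traceless_rep p q \<rho>" if "\<rho> \<in> ?X" for \<rho>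
    using that by (simp add: irred_traceless_reps_def)
  have ex_k: "\<exists>k\<in>{1..n}. ?angle \<rho> = ?\<theta> k" if "\<rho> \<in> ?X" for \<rho>
    unfolding n_def by (rule irreducible_angle[OF that assms(2)])
  have ex_rep: "\<exists>\<rho>\<in>?X. ?angle \<rho> = ?\<theta> k" if "k \<in> {1..n}" for k
    using that unfolding n_def by (rule std_rep_exists[OF assms(2)])
  have cos_inj: "inj_on (\<lambda>k. cos (?\<theta> k)) {1..n}"
  proof (rule inj_onI)
    fix k l assume kl: "k \<in> {1..n}" "l \<in> {1..n}" and "cos (?\<theta> k) = cos (?\<theta> l)"
    have bounds: "0 \<le> ?\<theta> j" "?\<theta> j \<le> pi" if "j \<in> {1..n}" for j
    proof -
      have "real (2 * j) \<le> real p" using that p by auto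
      then have "pi * real (2 * j) \<le> pi * real p" by (intro mult_left_mono) auto
      then show "?\<theta> j \<le> pi" using p by (simp add: divide_simps mult.commute mult.left_commute)
    qed simp
    have "?\<theta> k = ?\<theta> l"
      by (rule cos_inj_pi[OF bounds[OF kl(1)] bounds[OF kl(2)]]) fact
    then show "k = l" using p by simp
  qed
  have quot: "irred_traceless_characters p q = ?F ` {1..n}"
  proof -
    let ?r = "conj_reps (knot_group p q) \<inter> ?X \<times> ?X"
    \<comment> \<open>By \<open>conj_reps_iff\<close> the conjugacy classes are the level sets of
      the cosine of the angle.\<close>
    have cls: "?r `` {\<rho>} = {\<sigma> \<in> ?X. cos (?angle \<sigma>) = cos (?angle \<rho>)}" if "\<rho> \<in> ?X" for \<rho>
      using that conj_reps_iff[OF traceless[OF that] traceless] by auto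
    show ?thesis
    proof (intro equalityI subsetI)
      fix C assume "C \<in> irred_traceless_characters p q"
      then obtain \<rho> where \<rho>: "\<rho> \<in> ?X" "C = ?r `` {\<rho>}"
        unfolding irred_traceless_characters_def by (rule quotientE)
      then show "C \<in> ?F ` {1..n}" using ex_k[OF \<rho>(1)] cls[OF \<rho>(1)] by auto
    next
      fix C assume "C \<in> ?F ` {1..n}"
      then obtain k where k: "k \<in> {1..n}" "C = ?F k" by blast
      then obtain \<rho> where \<rho>: "\<rho> \<in> ?X" "?angle \<rho> = ?\<theta> k" using ex_rep by blast
      then have "C = ?r `` {\<rho>}" using k cls[OF \<rho>(1)] by simp
      then show "C \<in> irred_traceless_characters p q"
        unfolding irred_traceless_characters_def using \<rho>(1) by (blast intro: quotientI)
    qed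
  qed
  have "inj_on ?F {1..n}"
  proof (rule inj_onI)
    fix k l assume kl: "k \<in> {1..n}" "l \<in> {1..n}" "?F k = ?F l"
    obtain \<rho> where "\<rho> \<in> ?X" "?angle \<rho> = ?\<theta> k" using ex_rep[OF kl(1)] by blast
    then have "\<rho> \<in> ?F k" by simp
    with kl(3) have "\<rho> \<in> ?F l" by simp
    then have "cos (?\<theta> k) = cos (?\<theta> l)" using \<open>?angle \<rho> = ?\<theta> k\<close> by simp
    then show "k = l" using cos_inj kl(1,2) by (auto dest: inj_onD)
  qed
  then have bij: "bij_betw ?F {1..n} (irred_traceless_characters p q)"
    by (simp add: bij_betw_def quot)
  have riley: "traceless_riley p q = traceless_poly n"
    unfolding n_def by (rule traceless_riley_eq[OF assms(2)])
  have r: "- r k = of_real (2 * cos (?\<theta> k) - 2)" for k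
  proof -
    have "2 * cos (?\<theta> k) - 2 = - (4 * (sin (pi * real k / real p))\<^sup>2)"
      using cos_double_sin[of "pi * real k / real p"] by (simp add: algebra_simps)
    then show ?thesis by (simp only: r_def of_real_minus)
  qed
  \<comment> \<open>With \<open>x = pi k / p\<close> one has \<open>sin (p x) = 0\<close> but
    \<open>sin x \<noteq> 0\<close>, so \<open>traceless_poly_sin\<close> forces a zero of the
    polynomial.\<close>
  have root: "poly (traceless_poly n) (- r k) = 0" if "k \<in> {1..n}" for k
  proof -
    define x where "x = pi * real k / real p"
    have "real (2 * n + 1) * x = real k * pi" unfolding x_def p[symmetric] using p by simp
    then have "poly (traceless_poly n) (of_real (2 * cos (2 * x) - 2)) * of_real (sin x) = 0"
      unfolding traceless_poly_sin by (simp only: sin_npi of_real_0)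
    moreover have "sin x \<noteq> 0"
    proof -
      have "x > 0" using that p by (simp add: x_def)
      moreover have "real k < real p" using that p by auto
      then have "x < pi" using p by (simp add: x_def divide_simps)
      ultimately show ?thesis using sin_gt_zero by force
    qed
    ultimately show ?thesis unfolding r by (simp add: x_def mult.assoc)
  qed
  have prod: "traceless_poly n = (\<Prod>k\<in>{1..n}. [:r k, 1:])"
  proof (rule prod_linear_root_poly)
    show "inj_on r {1..n}"
    proof (rule inj_onI)
      fix k l assume kl: "k \<in> {1..n}" "l \<in> {1..n}" and "r k = r l"
      then have "complex_of_real (2 * cos (?\<theta> k) - 2) = of_real (2 * cos (?\<theta> l) - 2)"
        unfolding r[symmetric] by simp
      then have "cos (?\<theta> k) = cos (?\<theta> l)" by (simp only: of_real_eq_iff)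
      then show "k = l" using cos_inj kl by (auto dest: inj_onD)
    qed
  qed (use root in auto)
  have roots: "{u. poly (traceless_poly n) u = 0} = (\<lambda>k. - r k) ` {1..n}"
  proof (rule Set.set_eqI)
    fix u
    have "poly (traceless_poly n) u = 0 \<longleftrightarrow> (\<exists>k\<in>{1..n}. r k + u = 0)"
      unfolding prod by (simp add: poly_prod)
    moreover have "r k + u = 0 \<longleftrightarrow> u = - r k" for k
      by (simp only: eq_neg_iff_add_eq_0 add.commute)
    ultimately show "u \<in> {u. poly (traceless_poly n) u = 0} \<longleftrightarrow> u \<in> (\<lambda>k. - r k) ` {1..n}"
      by auto
  qed
  also have "\<dots> = (\<lambda>\<rho>. complex_of_real (2 * cos (?angle \<rho>) - 2)) ` ?X"
  proof (intro equalityI subsetI)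
    fix u assume "u \<in> (\<lambda>k. - r k) ` {1..n}"
    then obtain k where k: "k \<in> {1..n}" "u = - r k" by blast
    obtain \<rho> where "\<rho> \<in> ?X" "?angle \<rho> = ?\<theta> k" using ex_rep[OF k(1)] by blast
    then show "u \<in> (\<lambda>\<rho>. complex_of_real (2 * cos (?angle \<rho>) - 2)) ` ?X"
      unfolding k(2) r by (intro image_eqI[of _ _ \<rho>]) simp_all
  next
    fix u assume "u \<in> (\<lambda>\<rho>. complex_of_real (2 * cos (?angle \<rho>) - 2)) ` ?X"
    then obtain \<rho> where \<rho>: "\<rho> \<in> ?X" "u = complex_of_real (2 * cos (?angle \<rho>) - 2)" by blast
    obtain k where "k \<in> {1..n}" "?angle \<rho> = ?\<theta> k" using ex_k[OF \<rho>(1)] by blast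
    then show "u \<in> (\<lambda>k. - r k) ` {1..n}"
      unfolding \<rho>(2) by (intro image_eqI[of _ _ k]) (simp_all add: r)
  qed
  finally have roots': "{u. poly (traceless_poly n) u = 0}
    = (\<lambda>\<rho>. complex_of_real (2 * cos (?angle \<rho>) - 2)) ` ?X" .
  have "sum_mset (proots (traceless_poly n)) = sum_mset (\<Sum>k\<in>{1..n}. {#- r k#})"
    unfolding prod by (subst proots_prod) auto
  also have "\<dots> = (\<Sum>k\<in>{1..n}. - r k)"
    by (rule sum_mset_sum_singletons)
  also have "\<dots> = - (\<Sum>k\<in>{1..n}. r k)"
    by (rule sum_negf)
  \<comment> \<open>Vieta; \<open>n \<ge> 1\<close> ensures that \<open>n - 1\<close> is the index
    just below the degree.\<close>
  also have "\<dots> = - coeff (traceless_poly n) (n - 1)"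
    unfolding prod using coeff_prod_linear(2)[of "{1..n}" "n - 1" r] n by simp
  also have "\<dots> = - of_nat p"
    using coeff_traceless_poly_subtop[of "n - 1"] n by (simp add: p)
  finally have sum: "sum_mset (proots (traceless_poly n)) = - of_nat p" .
  have "poly (traceless_poly n) 0 = of_nat p"
    unfolding p by (rule traceless_poly_at_0)
  moreover have "lead_coeff (traceless_poly n) = 1" "degree (traceless_poly n) = n"
    by simp_all
  moreover have "finite (irred_traceless_characters p q)" "card (irred_traceless_characters p q) = n"
    using bij_betw_finite[OF bij] bij_betw_same_card[OF bij] by simp_all
  ultimately show ?thesis
    unfolding riley n_def[symmetric] det
    using bij roots' prod[unfolded r_def] sum traceless_rep_binary_dihedral[OF traceless]
      coeff_traceless_poly_Ints[of n]
    by (intro conjI ballI allI) simp_all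
qed

end
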